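(* Let $t\not\equiv 0\pmod 4$ be a fixed positive integer and let $n$ and $k<n$ be positive integers such that $t\mid 2nk$ and such that one of the following holds: (1) $nk$ is odd, $n\geq k\geq 3$, and $\gcd(n,k-1)=1$; (2) $nk$ is odd, $n\geq k$, and $3<k<200$; (3) $nk$ is odd, $n\geq k\geq 3$, and $n\geq (k-2)(k-1)$. Set $v=2nk+t$. Then there is a family of distinct biembeddings $\Pi$ of $K_{\frac{v}{t}\times t}$ such that (a) $\mathrm{Aut}(\Pi)=\mathbb{Z}_{v}$, (b) the faces determined by $\Pi$ have lengths multiples of $k$ strictly greater than $k$, whose cardinality is at least $$\left(1-\frac{2n}{nk-(k-1)}\right)\left(1-O\left(\tfrac{1}{nk}\right)\right)(nk)!=\left(1-O\left(\tfrac1k\right)\right)\left(1-O\left(\tfrac{1}{nk}\right)\right)(nk)!,$$ where the term $\left(1-O\left(\frac1k\right)\right)=1-\frac{2n}{nk-(k-1)}$ is strictly positive for any $k\geq 3$. Moreover, if $v$ is a prime (that can occur only if $t=1$), all the biembeddings of $K_v$ in this family are $kv$-gonal.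
   Context: Asymptotic convention: $t$ is fixed and the constant implied in $O(\frac{1}{nk})$ depends only on $t$. $K_{\frac{v}{t}\times t}$ is the complete multipartite graph with $v/t$ parts of size $t$ (so it is $K_v$ when $t=1$); its vertex set is identified with $\mathbb{Z}_v$, two vertices being adjacent iff their difference is not in the subgroup $J=\frac{v}{t}\mathbb{Z}_v$ of order $t$. A (combinatorial, orientable) embedding of a connected graph $\Gamma$ is a pair $\Pi=(\Gamma,\rho)$ where $\rho$ is a permutation of the oriented edges with $\rho(x,y)=(x,\rho_x(y))$, each $\rho_x$ being a cyclic permutation of all neighbours of $x$; this is equivalent to a cellular embedding into an orientable surface. Two embeddings of the same (labelled) graph are distinct if their rotations $\rho$ are different. Face boundaries are traced by the orbits of $(x,y)\mapsto\rho(y,x)$; the length of a face is the length of the orbit. A biembedding is an embedding whose faces can be coloured with two colours so that each edge lies on one face of each colour. An embedding is $\ell$-gonal if all its faces have length $\ell$. $\mathrm{Aut}(\Pi)$ is the group of graph automorphisms $\sigma$ (acting on oriented edges by $\sigma(x,y)=(\sigma(x),\sigma(y))$) such that either $\sigma\circ\rho=\rho\circ\sigma$ or $\sigma\circ\rho=\rho^{-1}\circ\sigma$; $\mathrm{Aut}(\Pi)=\mathbb{Z}_v$ means that it consists exactly of the translations $\tau_g(x)=x+g$, $g\in\mathbb{Z}_v$. *)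

theory Defs
  imports
    Complex_Main
    "HOL-Computational_Algebra.Primes"
    "HOL-Number_Theory.Cong"
    "HOL-Combinatorics.Orbits"
    "Graph_Theory.Pair_Digraph"
    "Graph_Theory.Digraph_Component"
begin

text \<open>
  Undirected simple graphs are symmetric loop-free digraphs (\<open>pair_graph\<close>), so that \<open>parcs G\<close>
  is the set of oriented edges, each edge \<open>{x, y}\<close> contributing \<open>(x, y)\<close> and \<open>(y, x)\<close>.
\<close>

definition neighbours :: "'a pair_pre_digraph \<Rightarrow> 'a \<Rightarrow> 'a set" where
  "neighbours G x = {y. (x, y) \<in> parcs G}"

text \<open>
  An embedding of \<open>G\<close> is given by its rotation \<open>\<rho>\<close>. As \<open>permutes\<close> makes \<open>\<rho>\<close> the identity off the
  oriented edges of \<open>G\<close>, two embeddings of \<open>G\<close> are distinct iff their rotations are distinct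
  functions. Note that \<open>orbit f x\<close> starts at \<open>f x\<close>; for a permutation of a finite set it
  contains \<open>x\<close>.
\<close>

definition embedding :: "'a pair_pre_digraph \<Rightarrow> ('a \<times> 'a \<Rightarrow> 'a \<times> 'a) \<Rightarrow> bool" where
  "embedding G \<rho> \<longleftrightarrow>
     pair_graph G \<and> Digraph_Component.connected (with_proj G) \<and> \<rho> permutes parcs G \<and>
     (\<forall>x \<in> pverts G. \<exists>r. r permutes neighbours G x \<and> cyclic_on r (neighbours G x) \<and>
        (\<forall>y \<in> neighbours G x. \<rho> (x, y) = (x, r y)))"

text \<open>A face is represented by the set of oriented edges tracing its boundary.\<close>

definition faces :: "'a pair_pre_digraph \<Rightarrow> ('a \<times> 'a \<Rightarrow> 'a \<times> 'a) \<Rightarrow> ('a \<times> 'a) set set" where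
  "faces G \<rho> = (\<lambda>e. orbit (\<lambda>(x, y). \<rho> (y, x)) e) ` parcs G"

definition edge_on_face :: "'a \<times> 'a \<Rightarrow> ('a \<times> 'a) set \<Rightarrow> bool" where
  "edge_on_face e F \<longleftrightarrow> e \<in> F \<or> prod.swap e \<in> F"

definition biembedding :: "'a pair_pre_digraph \<Rightarrow> ('a \<times> 'a \<Rightarrow> 'a \<times> 'a) \<Rightarrow> bool" where
  "biembedding G \<rho> \<longleftrightarrow>
     embedding G \<rho> \<and>
     (\<exists>colour :: ('a \<times> 'a) set \<Rightarrow> bool. \<forall>e \<in> parcs G. \<forall>c.
        \<exists>!F. F \<in> faces G \<rho> \<and> colour F = c \<and> edge_on_face e F)"

definition gonal :: "nat \<Rightarrow> 'a pair_pre_digraph \<Rightarrow> ('a \<times> 'a \<Rightarrow> 'a \<times> 'a) \<Rightarrow> bool" where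
  "gonal l G \<rho> \<longleftrightarrow> (\<forall>F \<in> faces G \<rho>. card F = l)"

definition graph_aut :: "'a pair_pre_digraph \<Rightarrow> ('a \<Rightarrow> 'a) set" where
  "graph_aut G = {\<sigma>. \<sigma> permutes pverts G \<and>
     (\<forall>x \<in> pverts G. \<forall>y \<in> pverts G. (\<sigma> x, \<sigma> y) \<in> parcs G \<longleftrightarrow> (x, y) \<in> parcs G)}"

definition embedding_aut ::
  "'a pair_pre_digraph \<Rightarrow> ('a \<times> 'a \<Rightarrow> 'a \<times> 'a) \<Rightarrow> ('a \<Rightarrow> 'a) set" where
  "embedding_aut G \<rho> = {\<sigma> \<in> graph_aut G.
     (\<forall>e \<in> parcs G. map_prod \<sigma> \<sigma> (\<rho> e) = \<rho> (map_prod \<sigma> \<sigma> e)) \<or>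
     (\<forall>e \<in> parcs G. map_prod \<sigma> \<sigma> (\<rho> e) = inv \<rho> (map_prod \<sigma> \<sigma> e))}"

text \<open>
  The cyclic group of order \<open>v\<close> has underlying set \<open>{0..<int v}\<close>, with arithmetic modulo \<open>v\<close>.
  Translations are extended by the identity, to match the use of \<open>permutes\<close> above.
\<close>

definition cyclic_translations :: "nat \<Rightarrow> (int \<Rightarrow> int) set" where
  "cyclic_translations v =
     (\<lambda>g x. if x \<in> {0..<int v} then (x + g) mod int v else x) ` {0..<int v}"

definition multiples_subgroup :: "nat \<Rightarrow> nat \<Rightarrow> int set" where
  "multiples_subgroup v m = (\<lambda>x. (int m * x) mod int v) ` {0..<int v}"

text \<open>
  The complete multipartite graph with \<open>v div t\<close> parts of size \<open>t\<close>, for \<open>t\<close> a divisor of \<open>v\<close>: its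
  parts are the cosets of the subgroup of order \<open>t\<close>.
\<close>

definition multipartite :: "nat \<Rightarrow> nat \<Rightarrow> int pair_pre_digraph" where
  "multipartite v t = \<lparr> pverts = {0..<int v},
     parcs = {(x, y). x \<in> {0..<int v} \<and> y \<in> {0..<int v} \<and>
                      (x - y) mod int v \<notin> multiples_subgroup v (v div t)} \<rparr>"

end

theory Submission
  imports Defs
begin

text \<open>
  All rotations are translates of one cyclic permutation of the set \<open>D\<close> of differences
  outside the subgroup of order \<open>t\<close>. Write it as a cyclic sequence \<open>e\<close> indexed by the integers
  modulo \<open>L = 2 n k\<close> with \<open>e (\<iota> p) = - e p\<close>, where the involution \<open>\<iota>\<close> exchanges even and odd
  indices. Faces are traced on indices by \<open>p \<mapsto> \<iota> p + 1\<close>; if all cycles of this map have length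
  \<open>k\<close>, then a face has length \<open>k\<close> times the order of a sum of \<open>k\<close> differences, and the parity of
  the indices is a two-colouring of the faces. Such an \<open>\<iota>\<close> is the same as a pair of permutations of
  \<open>n k\<close> points, each with all cycles of length \<open>k\<close>, whose product is a cycle of length \<open>n k\<close>;
  it exists whenever \<open>n\<close> and \<open>k \<ge> 3\<close> are odd.

  For a fixed \<open>\<iota>\<close> there are \<open>2 ^ (n k) * (n k)!\<close> sequences \<open>e\<close>, since one representative of each
  pair \<open>d, - d\<close> can be placed with either sign. The factor \<open>2 ^ (n k)\<close> leaves room for prescribing
  17 of the values, which makes \<open>e\<close> recoverable from the rotation and forces eight relations
  \<open>e q + e a = e b\<close> between values at known indices. An automorphism fixing a vertex acts on the
  indices by \<open>p \<mapsto> \<epsilon> p + i\<close> with \<open>\<epsilon> = 1\<close> or \<open>\<epsilon> = - 1\<close>, and turns each relation into another one.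
  Unless the action is trivial, two of the new relations are independent conditions on the free
  values, so they hold for a proportion \<open>O(1 / (n k)\<^sup>2)\<close> of all \<open>e\<close>; this beats the \<open>4 n k\<close> possible
  actions. Each of the \<open>2 n\<close> sums of \<open>k\<close> differences vanishes for a proportion \<open>O(1 / (n k))\<close>.
\<close>

section \<open>Translation-invariant rotations\<close>

lemma multiples_subgroup_iff:
  assumes "m dvd v" "0 < v"
  shows "x mod int v \<in> multiples_subgroup v m \<longleftrightarrow> int m dvd x"
proof
  assume "x mod int v \<in> multiples_subgroup v m"
  then obtain y where "x mod int v = (int m * y) mod int v"
    by (auto simp: multiples_subgroup_def)
  moreover have "int m dvd int v" using assms by simp
  ultimately show "int m dvd x"
    by (metis dvd_mod_iff dvd_triv_left)
next
  assume "int m dvd x"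
  then obtain y where y: "x = int m * y" by auto
  have "x mod int v = (int m * (y mod int v)) mod int v"
    by (simp add: y mod_mult_right_eq)
  then show "x mod int v \<in> multiples_subgroup v m"
    unfolding multiples_subgroup_def using assms by auto
qed

text \<open>\<open>w\<close> is the number of vertices, and \<open>e\<close> lists the admissible
  differences in cyclic order. As \<open>L\<close> is even, the parity of an index makes sense
  modulo \<open>L\<close>. The values of \<open>\<iota>\<close> are reduced modulo \<open>L\<close>,
  so applying it twice gives \<open>p mod L\<close> and not \<open>p\<close>.\<close>

locale cyclic_rotation =
  fixes w t :: nat and L :: int and e \<iota> :: "int \<Rightarrow> int"
  assumes t_pos: "0 < t" and t_dvd: "t dvd w" and parts: "t < w" and L_gt: "2 < L"
    and L_even: "even L"
    and e_eq: "e p = e q \<longleftrightarrow> p mod L = q mod L"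
    and e_range: "range e = {d \<in> {0..<int w}. \<not> int (w div t) dvd d}"
    and iota_mod: "\<iota> (p mod L) = \<iota> p"
    and iota_iota: "\<iota> (\<iota> p) = p mod L"
    and iota_parity: "even (\<iota> p) \<longleftrightarrow> odd p"
    and e_iota: "e (\<iota> p) = (- e p) mod int w"
begin

abbreviation "v \<equiv> int w"
abbreviation "m \<equiv> int (w div t)"
abbreviation "G \<equiv> multipartite w t"

definition "nbr x p = (x + e p) mod v"
definition "dart x p = (x, nbr x p)"
text \<open>The chosen index is unique modulo \<open>L\<close>, so the choice is harmless; off the
  arcs the value is the identity, as \<open>permutes\<close> demands.\<close>

definition "rot = (\<lambda>(x, y). if (x, y) \<in> parcs G
    then (x, nbr x ((SOME p. y = nbr x p) + 1)) else (x, y))"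

lemma v_pos: "0 < v" using parts by simp

lemma m_gt: "1 < m"
proof -
  have "w = t * (w div t)" using t_dvd by simp
  then have "w div t \<noteq> 0 \<and> w div t \<noteq> 1" using parts by (metis less_nat_zero_code mult.right_neutral mult_0_right nat_neq_iff)
  then show ?thesis by linarith
qed

lemma m_dvd: "m dvd v"
  using t_dvd by (metis dvd_div_mult_self dvd_triv_left int_dvd_int_iff)

lemma pverts_G: "pverts G = {0..<v}"
  by (simp add: multipartite_def)

lemma parcs_G: "(x, y) \<in> parcs G \<longleftrightarrow> x \<in> {0..<v} \<and> y \<in> {0..<v} \<and> \<not> m dvd (x - y)"
proof -
  have "w div t dvd w" using t_dvd by (metis dvd_div_mult_self dvd_triv_left)
  then show ?thesis using v_pos by (auto simp: multipartite_def multiples_subgroup_iff)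
qed

lemma e_bounds: "0 \<le> e p" "e p < v" "\<not> m dvd e p"
  using e_range by auto

lemma nbr_mem: "nbr x p \<in> {0..<v}" using v_pos by (simp add: nbr_def)

lemma nbr_eq: "nbr x p = nbr x q \<longleftrightarrow> p mod L = q mod L"
proof -
  have "nbr x p = nbr x q \<longleftrightarrow> e p mod v = e q mod v"
    by (simp add: nbr_def mod_eq_dvd_iff)
  also have "\<dots> \<longleftrightarrow> e p = e q" using e_bounds by simp
  finally show ?thesis by (simp add: e_eq)
qed

lemma m_dvd_mod: "m dvd (x mod v) \<longleftrightarrow> m dvd x"
  using m_dvd by (simp add: dvd_mod_iff)

lemma nbr_arc: "x \<in> {0..<v} \<Longrightarrow> (x, nbr x p) \<in> parcs G"
proof -
  assume x: "x \<in> {0..<v}"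
  have "m dvd (x - nbr x p) \<longleftrightarrow> m dvd (x - nbr x p) mod v" by (simp add: m_dvd_mod)
  also have "(x - nbr x p) mod v = (- e p) mod v" by (simp add: nbr_def mod_simps)
  also have "m dvd (- e p) mod v \<longleftrightarrow> m dvd e p" by (simp add: m_dvd_mod)
  finally show ?thesis using x nbr_mem e_bounds by (simp add: parcs_G)
qed

lemma arc_nbr:
  assumes "(x, y) \<in> parcs G" obtains p where "x \<in> {0..<v}" "y = nbr x p"
proof -
  have "\<not> m dvd (y - x) mod v" using assms by (simp add: parcs_G m_dvd_mod dvd_diff_commute)
  then have "(y - x) mod v \<in> range e" using v_pos unfolding e_range by simp
  then obtain p where "(y - x) mod v = e p" by auto
  then have "nbr x p = (x + (y - x) mod v) mod v" by (simp add: nbr_def)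
  also have "\<dots> = y" using assms by (simp add: mod_simps parcs_G)
  finally show ?thesis using that assms by (auto simp: parcs_G)
qed

lemma dart_arc: "x \<in> {0..<v} \<Longrightarrow> dart x p \<in> parcs G"
  by (simp add: dart_def nbr_arc)

lemma arc_dart:
  assumes "a \<in> parcs G" obtains x p where "x \<in> {0..<v}" "a = dart x p"
proof -
  obtain p where "fst a \<in> {0..<v}" "snd a = nbr (fst a) p" using assms by (metis arc_nbr prod.collapse)
  then show ?thesis using that by (metis dart_def prod.collapse)
qed

lemma iota_range: "\<iota> p mod L = \<iota> p"
  by (metis iota_iota iota_mod)

lemma nbr_iota: "x \<in> {0..<v} \<Longrightarrow> nbr (nbr x p) (\<iota> p) = x"
  by (simp add: nbr_def e_iota mod_simps)

lemma rot_dart: assumes "x \<in> {0..<v}" shows "rot (dart x p) = dart x (p + 1)"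
proof -
  let ?q = "SOME q. nbr x p = nbr x q"
  have "nbr x p = nbr x ?q" by (rule someI) simp
  then have "p mod L = ?q mod L" by (simp add: nbr_eq)
  then have "(?q + 1) mod L = (p + 1) mod L" by (metis mod_add_left_eq)
  then show ?thesis using assms nbr_arc by (simp add: rot_def dart_def nbr_eq)
qed

lemma dart_eq: "dart x p = dart y q \<longleftrightarrow> x = y \<and> p mod L = q mod L"
  by (auto simp: dart_def nbr_eq)

lemma rot_permutes: "rot permutes parcs G"
proof (rule bij_imp_permutes)
  show "bij_betw rot (parcs G) (parcs G)"
  proof (rule bij_betwI')
    fix a b assume "a \<in> parcs G" "b \<in> parcs G"
    then obtain x p y q where *: "a = dart x p" "x \<in> {0..<v}" "b = dart y q" "y \<in> {0..<v}"
      by (metis arc_dart)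
    have "(p + 1) mod L = (q + 1) mod L \<longleftrightarrow> p mod L = q mod L"
      by (simp add: mod_eq_dvd_iff)
    then show "(rot a = rot b) = (a = b)" using * by (simp add: rot_dart dart_eq)
  next
    fix a assume "a \<in> parcs G"
    then show "rot a \<in> parcs G" by (metis arc_dart rot_dart dart_arc)
  next
    fix b assume "b \<in> parcs G"
    then obtain x p where *: "b = dart x p" "x \<in> {0..<v}" by (metis arc_dart)
    then have "b = rot (dart x (p - 1))" by (simp add: rot_dart)
    then show "\<exists>a\<in>parcs G. b = rot a" using * dart_arc by blast
  qed
next
  fix a assume "a \<notin> parcs G" then show "rot a = a" by (auto simp: rot_def split: prod.splits)
qed

section \<open>The rotation as an embedding of a connected graph\<close>

lemma pair_graph_G: "pair_graph G"
proof unfold_locales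
  show "finite (pverts G)" by (simp add: pverts_G)
  have "parcs G \<subseteq> {0..<v} \<times> {0..<v}" by (auto simp: parcs_G)
  then show "finite (parcs G)" by (rule finite_subset) simp
  show "symmetric (with_proj G)"
    by (auto simp: symmetric_def sym_def parcs_G dvd_diff_commute)
qed (auto simp: pverts_G parcs_G split_pairs)

text \<open>Vertices of the same part are joined through \<open>x + 1\<close>, which lies in another
  part because 1 is not a multiple of \<open>m\<close>. Besides connectedness, this lets a property
  that spreads along arcs reach every vertex from 0.\<close>

lemma two_step:
  assumes x: "x \<in> {0..<v}" and y: "y \<in> {0..<v}"
  obtains "(x, y) \<in> parcs G" | z where "(x, z) \<in> parcs G" "(z, y) \<in> parcs G"
proof (cases "m dvd (x - y)")
  case True
  let ?z = "(x + 1) mod v"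
  have a: "\<not> m dvd (x - ?z)"
  proof -
    have "m dvd (x - ?z) \<longleftrightarrow> m dvd (x - ?z) mod v" by (simp add: m_dvd_mod)
    also have "(x - ?z) mod v = (- 1) mod v" by (simp add: mod_simps)
    also have "m dvd (- 1) mod v \<longleftrightarrow> m dvd - 1" by (rule m_dvd_mod)
    finally show ?thesis using m_gt by (auto simp: zdvd_not_zless)
  qed
  have "x - y = (x - ?z) + (?z - y)" by simp
  then have "\<not> m dvd (?z - y)" using True a by (metis dvd_add_left_iff)
  then show ?thesis using a assms v_pos by (intro that(2)[of ?z]) (auto simp: parcs_G)
next
  case False
  then show ?thesis using assms by (intro that(1)) (auto simp: parcs_G)
qed

lemma connected_G: "Digraph_Component.connected (with_proj G)"
proof -
  interpret pair_graph G by (rule pair_graph_G)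
  let ?R = "rtrancl_on (pverts G) ((parcs G)\<^sup>s)"
  have step: "(x, y) \<in> ?R \<Longrightarrow> (y, z) \<in> parcs G \<Longrightarrow> (x, z) \<in> ?R" for x y z
    by (rule rtrancl_on_into_rtrancl_on) (auto simp: symcl_def pverts_G parcs_G)
  have "(x, y) \<in> ?R" if xy: "x \<in> {0..<v}" "y \<in> {0..<v}" for x y
  proof -
    have "(x, x) \<in> ?R" using xy by (simp add: pverts_G)
    with step show ?thesis using two_step[OF xy] by metis
  qed
  then show ?thesis using v_pos by (simp add: connected_conv pverts_G)
qed

lemma embedding_rot: "embedding G rot"
  unfolding embedding_def
proof (intro conjI ballI pair_graph_G connected_G rot_permutes)
  fix x assume "x \<in> pverts G"
  then have x: "x \<in> {0..<v}" by (simp add: pverts_G)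
  define r where "r y = snd (rot (x, y))" for y
  have r: "r (nbr x p) = nbr x (p + 1)" for p
    using rot_dart[OF x, of p] by (simp add: r_def dart_def)
  have N: "neighbours G x = range (nbr x)"
    using x nbr_arc unfolding neighbours_def
    by (intro set_eqI iffI) (auto elim!: arc_nbr simp del: atLeastLessThan_iff)
  show "\<exists>r. r permutes neighbours G x \<and> cyclic_on r (neighbours G x) \<and>
      (\<forall>y\<in>neighbours G x. rot (x, y) = (x, r y))"
  proof (intro exI conjI ballI)
    show "r permutes neighbours G x"
    proof (rule bij_imp_permutes)
      show "bij_betw r (neighbours G x) (neighbours G x)"
      proof (rule bij_betwI')
        fix a b assume "a \<in> neighbours G x" "b \<in> neighbours G x"
        then obtain p q where *: "a = nbr x p" "b = nbr x q" by (auto simp: N)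
        have "(p + 1) mod L = (q + 1) mod L \<longleftrightarrow> p mod L = q mod L" by (simp add: mod_eq_dvd_iff)
        then show "(r a = r b) = (a = b)" using * by (simp add: r nbr_eq)
      next
        fix a assume "a \<in> neighbours G x" then show "r a \<in> neighbours G x" by (auto simp: N r)
      next
        fix b assume "b \<in> neighbours G x"
        then obtain p where "b = nbr x p" by (auto simp: N)
        then have "b = r (nbr x (p - 1))" by (simp add: r)
        then show "\<exists>a\<in>neighbours G x. b = r a" by (auto simp: N)
      qed
      show "r a = a" if "a \<notin> neighbours G x" for a
        using that by (simp add: neighbours_def r_def rot_def)
    qed
    show "cyclic_on r (neighbours G x)" unfolding cyclic_on_def
    proof
      show "nbr x 0 \<in> neighbours G x" by (auto simp: N)
      have pow: "(r ^^ j) (nbr x 0) = nbr x (int j)" for j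
        by (induction j) (auto simp: r add.commute)
      have "nbr x p \<in> orbit r (nbr x 0)" for p
      proof -
        \<comment> \<open>\<open>orbit\<close> consists of positive iterates only; adding
          \<open>L\<close> keeps the exponent positive when \<open>p mod L = 0\<close>.\<close>
        have "nbr x p = (r ^^ nat (p mod L + L)) (nbr x 0)"
          using L_gt by (simp add: pow nbr_eq)
        then show ?thesis using L_gt unfolding orbit_altdef
          by (intro CollectI exI[of _ "nat (p mod L + L)"]) (simp add: add_nonneg_pos)
      qed
      then show "neighbours G x = orbit r (nbr x 0)"
        by (auto simp: N orbit_altdef pow)
    qed
    fix y assume "y \<in> neighbours G x"
    then show "rot (x, y) = (x, r y)" using rot_dart[OF x] by (auto simp: N r_def dart_def)
  qed
qed

section \<open>Automorphisms\<close>

lemma inv_rot_dart: "x \<in> {0..<v} \<Longrightarrow> inv rot (dart x p) = dart x (p - 1)"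
  using permutes_inv_eq[OF rot_permutes, of "dart x p" "dart x (p - 1)"] rot_dart[of x "p - 1"]
  by simp

lemma translation_dart:
  assumes "x \<in> {0..<v}" shows "(nbr x p + g) mod v = nbr ((x + g) mod v) p"
  by (simp add: nbr_def mod_simps ac_simps)

lemma cyclic_translations_subset: "cyclic_translations w \<subseteq> embedding_aut G rot"
proof
  fix \<sigma> assume "\<sigma> \<in> cyclic_translations w"
  then obtain g where g: "\<sigma> = (\<lambda>x. if x \<in> {0..<v} then (x + g) mod v else x)"
    by (auto simp: cyclic_translations_def)
  have mem: "\<sigma> x \<in> {0..<v}" if "x \<in> {0..<v}" for x using that v_pos by (simp add: g)
  have "\<sigma> permutes pverts G" unfolding pverts_G
  proof (rule bij_imp_permutes)
    show "bij_betw \<sigma> {0..<v} {0..<v}"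
    proof (rule bij_betwI')
      fix x y assume *: "x \<in> {0..<v}" "y \<in> {0..<v}"
      have "(x + g) mod v = (y + g) mod v \<longleftrightarrow> x mod v = y mod v" by (simp add: mod_eq_dvd_iff)
      then show "(\<sigma> x = \<sigma> y) = (x = y)" using * by (simp add: g)
    next
      fix y assume y: "y \<in> {0..<v}"
      then have "y = \<sigma> ((y - g) mod v)" using v_pos by (simp add: g mod_simps)
      then show "\<exists>x\<in>{0..<v}. y = \<sigma> x" using v_pos by (intro bexI[of _ "(y - g) mod v"]) auto
    qed (rule mem)
  qed (simp add: g del: atLeastLessThan_iff)
  moreover have "(\<sigma> x, \<sigma> y) \<in> parcs G \<longleftrightarrow> (x, y) \<in> parcs G"
    if xy: "x \<in> {0..<v}" "y \<in> {0..<v}" for x y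
  proof -
    have "m dvd \<sigma> x - \<sigma> y \<longleftrightarrow> m dvd (\<sigma> x - \<sigma> y) mod v" by (simp add: m_dvd_mod)
    also have "(\<sigma> x - \<sigma> y) mod v = (x - y) mod v" using xy by (simp add: g mod_simps)
    finally show ?thesis using xy mem by (simp add: parcs_G m_dvd_mod del: atLeastLessThan_iff)
  qed
  moreover have "map_prod \<sigma> \<sigma> (rot a) = rot (map_prod \<sigma> \<sigma> a)" if a0: "a \<in> parcs G" for a
  proof -
    obtain x p where x: "x \<in> {0..<v}" and a: "a = dart x p" using a0 by (rule arc_dart)
    have *: "map_prod \<sigma> \<sigma> (dart x q) = dart (\<sigma> x) q" for q
      using translation_dart[OF x] nbr_mem[of x] x by (simp add: dart_def g)
    show ?thesis using x mem by (simp add: a * rot_dart del: atLeastLessThan_iff)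
  qed
  ultimately show "\<sigma> \<in> embedding_aut G rot"
    by (simp add: embedding_aut_def graph_aut_def pverts_G del: atLeastLessThan_iff)
qed

text \<open>Compatibility with the rotation forces an automorphism to act on the indices at each
  vertex by an affine map, with one common slope \<epsilon>. A relation
  \<open>e q + e a = e b\<close> is a triangle with vertices 0, \<open>e q\<close> and
  \<open>e b\<close>, whose image is again a triangle; \<open>rigid\<close> says that only the
  trivial affine map at 0 respects all of these triangles.\<close>

lemma embedding_aut_rot:
  assumes rigid: "\<And>\<epsilon> i. \<epsilon> \<in> {1, - 1} \<Longrightarrow>
    (\<And>q a b. v dvd e q + e a - e b \<Longrightarrow>
      v dvd e (\<epsilon> * q + i) + e (\<iota> (\<epsilon> * q + i) + \<epsilon> * (a - \<iota> q)) - e (\<epsilon> * b + i)) \<Longrightarrow>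
    \<epsilon> = 1 \<and> L dvd i"
  shows "embedding_aut G rot = cyclic_translations w"
proof (intro equalityI subsetI)
  fix \<sigma> assume \<sigma>: "\<sigma> \<in> embedding_aut G rot"
  then have perm: "\<sigma> permutes {0..<v}"
    and arcs: "x \<in> {0..<v} \<Longrightarrow> y \<in> {0..<v} \<Longrightarrow> (x, y) \<in> parcs G \<Longrightarrow> (\<sigma> x, \<sigma> y) \<in> parcs G" for x y
    by (auto simp: embedding_aut_def graph_aut_def pverts_G simp del: atLeastLessThan_iff)
  have mem: "\<sigma> x \<in> {0..<v}" if "x \<in> {0..<v}" for x
    using permutes_in_image[OF perm] that by blast
  have "\<exists>q. \<sigma> (nbr x p) = nbr (\<sigma> x) q" if "x \<in> {0..<v}" for x p
    using arcs[OF that nbr_mem nbr_arc[OF that]] by (metis arc_nbr)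
  \<comment> \<open>\<open>M x p\<close> is the index at \<open>\<sigma> x\<close> of the image of
    the neighbour that has index \<open>p\<close> at \<open>x\<close>.\<close>
  then obtain M where M: "x \<in> {0..<v} \<Longrightarrow> \<sigma> (nbr x p) = nbr (\<sigma> x) (M x p)" for x p by metis
  have img: "map_prod \<sigma> \<sigma> (dart x p) = dart (\<sigma> x) (M x p)" if "x \<in> {0..<v}" for x p
    using M[OF that] by (simp add: dart_def)
  obtain \<epsilon> where eps: "\<epsilon> \<in> {1, - 1::int}"
    and step: "x \<in> {0..<v} \<Longrightarrow> M x (p + 1) mod L = (M x p + \<epsilon>) mod L" for x p
  proof -
    from \<sigma> consider "\<forall>a \<in> parcs G. map_prod \<sigma> \<sigma> (rot a) = rot (map_prod \<sigma> \<sigma> a)"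
      | "\<forall>a \<in> parcs G. map_prod \<sigma> \<sigma> (rot a) = inv rot (map_prod \<sigma> \<sigma> a)"
      by (auto simp: embedding_aut_def)
    then show ?thesis
    proof cases
      case 1
      have "M x (p + 1) mod L = (M x p + 1) mod L" if x: "x \<in> {0..<v}" for x p
        using 1[rule_format, OF dart_arc[OF x, of p]] mem[OF x]
        by (simp add: rot_dart[OF x] img[OF x] rot_dart dart_eq del: atLeastLessThan_iff)
      then show ?thesis by (intro that[of 1]) auto
    next
      case 2
      have "M x (p + 1) mod L = (M x p + -1) mod L" if x: "x \<in> {0..<v}" for x p
        using 2[rule_format, OF dart_arc[OF x, of p]] mem[OF x]
        by (simp add: rot_dart[OF x] img[OF x] inv_rot_dart dart_eq del: atLeastLessThan_iff)
      then show ?thesis by (intro that[of "-1"]) auto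
    qed
  qed
  have lin: "M x (p + d) mod L = (M x p + \<epsilon> * d) mod L" if x: "x \<in> {0..<v}" for x p d
  proof (induction d rule: int_induct[of _ 0])
    case base
    show ?case by simp
  next
    case (step1 d)
    have "M x (p + (d + 1)) mod L = (M x (p + d) + \<epsilon>) mod L" using step[OF x, of "p + d"] by (simp add: ac_simps)
    also have "\<dots> = (M x p + \<epsilon> * d + \<epsilon>) mod L" using step1 by (metis mod_add_left_eq)
    finally show ?case by (simp add: algebra_simps)
  next
    case (step2 d)
    have "(M x (p + (d - 1)) + \<epsilon>) mod L = (M x p + \<epsilon> * d) mod L"
      using step[OF x, of "p + (d - 1)"] step2 by (simp add: algebra_simps)
    then have "(M x (p + (d - 1)) + \<epsilon> - \<epsilon>) mod L = (M x p + \<epsilon> * d - \<epsilon>) mod L" by (metis mod_diff_left_eq)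
    then show ?case by (simp add: algebra_simps)
  qed
  \<comment> \<open>The reverse of the arc with index \<open>p\<close> has index
    \<open>\<iota> p\<close> at its other end, and \<sigma> commutes with reversal. This ties the
    affine maps at adjacent vertices together.\<close>
  have rev: "M (nbr x p) (\<iota> p) mod L = \<iota> (M x p)" if x: "x \<in> {0..<v}" for x p
  proof -
    have "nbr (\<sigma> (nbr x p)) (M (nbr x p) (\<iota> p)) = \<sigma> x"
      using M[OF nbr_mem, of x p "\<iota> p"] nbr_iota[OF x] by simp
    also have "\<dots> = nbr (\<sigma> (nbr x p)) (\<iota> (M x p))"
      using nbr_iota[OF mem[OF x]] M[OF x] by simp
    finally show ?thesis by (simp add: nbr_eq iota_range)
  qed
  have zero: "0 \<in> {0..<v}" using v_pos by simp
  let ?c = "M 0 0"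
  have M0: "M 0 p mod L = (\<epsilon> * p + ?c) mod L" for p
    using lin[OF zero, of 0 p] by (simp add: add.commute)
  have e0: "e (M 0 p) = e (\<epsilon> * p + ?c)" for p using M0 e_eq by blast
  have nbr0: "nbr 0 p = e p" for p using e_bounds by (simp add: nbr_def)
  have "\<epsilon> = 1 \<and> L dvd ?c"
  proof (rule rigid[OF eps])
    fix q a b assume *: "v dvd e q + e a - e b"
    have ab: "nbr (e q) a = nbr 0 b"
      using * e_bounds by (simp add: nbr_def flip: mod_eq_dvd_iff)
    have eq: "e q \<in> {0..<v}" using e_bounds by simp
    have "M (e q) a mod L = (M (e q) (\<iota> q) + \<epsilon> * (a - \<iota> q)) mod L"
      using lin[OF eq, of "\<iota> q" "a - \<iota> q"] by simp
    also have "\<dots> = (M (e q) (\<iota> q) mod L + \<epsilon> * (a - \<iota> q)) mod L" by (simp add: mod_simps)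
    also have "M (e q) (\<iota> q) mod L = \<iota> (\<epsilon> * q + ?c)"
      using rev[OF zero, of q] M0[of q] by (simp add: nbr0) (metis iota_mod)
    finally have Ma: "e (M (e q) a) = e (\<iota> (\<epsilon> * q + ?c) + \<epsilon> * (a - \<iota> q))" by (simp add: e_eq)
    have "nbr (\<sigma> (e q)) (M (e q) a) = nbr (\<sigma> 0) (M 0 b)"
      using M[OF eq, of a] M[OF zero, of b] ab by simp
    moreover have "\<sigma> (e q) = nbr (\<sigma> 0) (M 0 q)" using M[OF zero, of q] by (simp add: nbr0)
    ultimately have "nbr (nbr (\<sigma> 0) (M 0 q)) (M (e q) a) = nbr (\<sigma> 0) (M 0 b)" by simp
    then have "(\<sigma> 0 + e (M 0 q) + e (M (e q) a)) mod v = (\<sigma> 0 + e (M 0 b)) mod v"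
      by (simp add: nbr_def mod_simps)
    then have "v dvd \<sigma> 0 + e (M 0 q) + e (M (e q) a) - (\<sigma> 0 + e (M 0 b))"
      by (simp only: mod_eq_dvd_iff)
    then show "v dvd e (\<epsilon> * q + ?c) + e (\<iota> (\<epsilon> * q + ?c) + \<epsilon> * (a - \<iota> q)) - e (\<epsilon> * b + ?c)"
      by (simp add: e0 Ma algebra_simps)
  qed
  then have eps1: "\<epsilon> = 1" and c: "L dvd ?c" by auto
  \<comment> \<open>Once the action at 0 is trivial, \<open>rev\<close> carries triviality across
    each arc, and \<sigma> is seen to be the translation by \<open>\<sigma> 0\<close>.\<close>
  define P where "P x \<longleftrightarrow> (\<forall>p. M x p mod L = p mod L) \<and> \<sigma> x = (x + \<sigma> 0) mod v" for x
  have "(p + ?c) mod L = p mod L" for p using c by (simp add: mod_eq_dvd_iff)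
  then have P0: "P 0" using M0 mem[OF zero] by (auto simp: P_def eps1)
  have Pstep: "P y" if "P x" "(x, y) \<in> parcs G" for x y
  proof -
    obtain p where x: "x \<in> {0..<v}" and y: "y = nbr x p" using arc_nbr[OF \<open>(x, y) \<in> parcs G\<close>] by metis
    have Mx: "M x q mod L = q mod L" for q using that(1) by (simp add: P_def)
    have "M y (\<iota> p) mod L = \<iota> p" using rev[OF x, of p] Mx[of p] by (metis y iota_mod)
    then have "M y q mod L = q mod L" for q
      using lin[OF nbr_mem, of x p "\<iota> p" "q - \<iota> p"] unfolding y eps1
      by simp (metis add_diff_cancel_left' diff_add_cancel mod_add_left_eq add.commute)
    moreover have "\<sigma> y = (y + \<sigma> 0) mod v"
    proof -
      have "\<sigma> y = nbr (\<sigma> x) p" using M[OF x, of p] Mx by (simp add: y nbr_eq)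
      also have "\<dots> = (y + \<sigma> 0) mod v" using that(1) translation_dart[OF x] by (simp add: P_def y)
      finally show ?thesis .
    qed
    ultimately show ?thesis by (simp add: P_def)
  qed
  have P: "P x" if "x \<in> {0..<v}" for x
    using two_step[OF zero that] Pstep P0 by metis
  have "\<sigma> = (\<lambda>x. if x \<in> {0..<v} then (x + \<sigma> 0) mod v else x)"
  proof
    fix x show "\<sigma> x = (if x \<in> {0..<v} then (x + \<sigma> 0) mod v else x)"
      using P[of x] permutes_not_in[OF perm, of x] by (auto simp: P_def)
  qed
  then show "\<sigma> \<in> cyclic_translations w" unfolding cyclic_translations_def using mem[OF zero] by blast
qed (use cyclic_translations_subset in blast)

section \<open>Tracing faces on indices\<close>

definition "face_step p = \<iota> p + 1"

abbreviation "face_map \<equiv> (\<lambda>(x, y). rot (y, x))"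

text \<open>Reversal replaces the index \<open>p\<close> by \<open>\<iota> p\<close> and the
  rotation adds 1, so the indices along a face evolve independently of the vertices.\<close>

lemma face_map_dart:
  assumes "x \<in> {0..<v}" shows "face_map (dart x p) = dart (nbr x p) (face_step p)"
  using rot_dart[OF nbr_mem, of x p "\<iota> p"] nbr_iota[OF assms]
  by (simp add: dart_def face_step_def)

lemma face_map_funpow:
  assumes x: "x \<in> {0..<v}"
  shows "(face_map ^^ j) (dart x p) = dart ((x + (\<Sum>i<j. e ((face_step ^^ i) p))) mod v) ((face_step ^^ j) p)"
proof (induction j)
  case 0
  show ?case using x by simp
next
  case (Suc j)
  have "(x + (\<Sum>i<j. e ((face_step ^^ i) p))) mod v \<in> {0..<v}" using v_pos by simp
  then show ?case by (simp add: Suc face_map_dart) (simp add: nbr_def mod_simps ac_simps)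
qed

lemma face_step_parity: "even (face_step p) \<longleftrightarrow> even p"
  by (simp add: face_step_def iota_parity)

lemma face_step_funpow_parity: "even ((face_step ^^ j) p) \<longleftrightarrow> even p"
  by (induction j) (auto simp: face_step_parity)

lemma face_step_cong: "p mod L = q mod L \<Longrightarrow> face_step p = face_step q"
  by (metis face_step_def iota_mod)

lemma face_step_funpow_cong: "p mod L = q mod L \<Longrightarrow> (face_step ^^ j) p mod L = (face_step ^^ j) q mod L"
  by (induction j) (auto dest: face_step_cong)

definition "cycle_sum k p = (\<Sum>i<k. e ((face_step ^^ i) p))"

end

lemma funpow_orbit_card:
  assumes per: "\<And>j. (f ^^ j) x = x \<longleftrightarrow> c dvd j" and c: "0 < (c::nat)"
  shows "x \<in> orbit f x" "card (orbit f x) = c"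
proof -
  have c': "(f ^^ c) x = x" by (simp add: per)
  then have orb: "orbit f x = {(f ^^ m) x | m. m < c}" using c by (rule orbit_altdef_bounded)
  show "x \<in> orbit f x" unfolding orb using c by (auto intro!: exI[of _ 0])
  have ne: "(f ^^ a) x \<noteq> (f ^^ b) x" if "a < b" "b < c" for a b
  proof
    assume "(f ^^ a) x = (f ^^ b) x"
    then have "(f ^^ (c - b + a)) x = (f ^^ (c - b + b)) x" by (simp only: funpow_add o_apply)
    also have "c - b + b = c" using that by simp
    finally have "(f ^^ (c - b + a)) x = x" by (simp only: c')
    then have "c dvd c - b + a" by (simp add: per)
    then show False using that by (auto dest: dvd_imp_le)
  qed
  then have "inj_on (\<lambda>m. (f ^^ m) x) {..<c}"
    unfolding inj_on_def by (metis lessThan_iff linorder_neqE_nat)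
  moreover have "orbit f x = (\<lambda>m. (f ^^ m) x) ` {..<c}" by (auto simp: orb)
  ultimately show "card (orbit f x) = c" by (simp add: card_image)
qed

section \<open>Face lengths and the two-colouring\<close>

locale periodic_rotation = cyclic_rotation +
  fixes k :: nat
  assumes k_pos: "0 < k"
    and period: "(face_step ^^ j) p mod L = p mod L \<longleftrightarrow> k dvd j"
begin

text \<open>The index returns after \<open>k\<close> steps, so every round displaces the vertex by
  the same sum.\<close>

lemma cycle_sum_mult: "(\<Sum>i<k * q. e ((face_step ^^ i) p)) = int q * cycle_sum k p"
proof (induction q)
  case (Suc q)
  have split: "sum f {..<a + b} = sum f {..<a} + (\<Sum>i<b. f (a + i))" for f :: "nat \<Rightarrow> int" and a b
    by (induction b) auto
  have "e ((face_step ^^ (k * q + i)) p) = e ((face_step ^^ i) p)" for i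
  proof -
    have "(face_step ^^ (k * q)) p mod L = p mod L" by (simp add: period)
    then have "(face_step ^^ i) ((face_step ^^ (k * q)) p) mod L = (face_step ^^ i) p mod L"
      by (rule face_step_funpow_cong)
    then show ?thesis unfolding e_eq add.commute[of "k * q"] by (simp only: funpow_add o_apply)
  qed
  then have shift: "(\<Sum>i<k. e ((face_step ^^ (k * q + i)) p)) = cycle_sum k p"
    by (simp only: cycle_sum_def)
  have "k * Suc q = k * q + k" by simp
  then have "(\<Sum>i<k * Suc q. e ((face_step ^^ i) p)) = int q * cycle_sum k p + cycle_sum k p"
    by (simp only: split shift Suc)
  then show ?case by (simp only: of_nat_Suc distrib_right mult_1 add.commute)
qed simp

text \<open>The sum belongs to the cycle of indices and not to its starting point, so it suffices to
  test one index of each cycle.\<close>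

lemma cycle_sum_step: "cycle_sum k (face_step p) = cycle_sum k p"
proof -
  have "cycle_sum k p + e ((face_step ^^ k) p) = (\<Sum>i<Suc k. e ((face_step ^^ i) p))"
    by (simp add: cycle_sum_def)
  also have "\<dots> = e p + cycle_sum k (face_step p)"
    by (subst sum.lessThan_Suc_shift) (simp add: cycle_sum_def funpow_swap1)
  finally show ?thesis using period[of k p] e_eq[of "(face_step ^^ k) p" p] by simp
qed

text \<open>A face closes after \<open>j\<close> steps exactly when the index returns, that is
  \<open>k dvd j\<close>, and the vertex returns, that is \<open>v\<close> divides
  \<open>j div k\<close> times the cycle sum. The second factor of \<open>c\<close> is the additive
  order of the cycle sum modulo \<open>v\<close>.\<close>

lemma face_orbit:
  fixes p assumes x: "x \<in> {0..<v}"
  defines "c \<equiv> k * nat (v div gcd v (cycle_sum k p))"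
  shows "dart x p \<in> orbit face_map (dart x p)" "card (orbit face_map (dart x p)) = c"
proof -
  let ?s = "cycle_sum k p" and ?o = "nat (v div gcd v (cycle_sum k p))"
  have g: "gcd v ?s > 0" using v_pos by simp
  have "v = v div gcd v ?s * gcd v ?s" by simp
  then have "0 < v div gcd v ?s" using v_pos g by (metis zero_less_mult_pos2)
  then have o: "0 < ?o" "int ?o = v div gcd v ?s" by auto
  have dvd: "v dvd int q * ?s \<longleftrightarrow> ?o dvd q" for q
  proof -
    have "v dvd int q * ?s \<longleftrightarrow> (v div gcd v ?s) * gcd v ?s dvd int q * (?s div gcd v ?s) * gcd v ?s"
      by (simp only: mult.assoc dvd_div_mult_self[OF gcd_dvd1] dvd_div_mult_self[OF gcd_dvd2])
    also have "\<dots> \<longleftrightarrow> v div gcd v ?s dvd int q * (?s div gcd v ?s)" using g by (subst dvd_mult_cancel_right) auto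
    also have "\<dots> \<longleftrightarrow> v div gcd v ?s dvd int q"
      using v_pos by (intro coprime_dvd_mult_left_iff div_gcd_coprime) auto
    finally show ?thesis using o(2) by (metis int_dvd_int_iff)
  qed
  have per: "(face_map ^^ j) (dart x p) = dart x p \<longleftrightarrow> c dvd j" for j
  proof -
    have "(face_map ^^ j) (dart x p) = dart x p \<longleftrightarrow>
        v dvd (\<Sum>i<j. e ((face_step ^^ i) p)) \<and> k dvd j"
    proof -
      have "(x + s) mod v = x \<longleftrightarrow> v dvd s" for s
      proof -
        have "(x + s) mod v = x \<longleftrightarrow> (x + s) mod v = x mod v" using x by simp
        then show ?thesis by (simp add: mod_eq_dvd_iff)
      qed
      then show ?thesis by (simp add: face_map_funpow[OF x] dart_eq period)
    qed
    also have "\<dots> \<longleftrightarrow> c dvd j"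
    proof (cases "k dvd j")
      case True
      then obtain q where "j = k * q" by auto
      then show ?thesis using k_pos by (simp add: cycle_sum_mult dvd c_def)
    next
      case False
      then show ?thesis by (auto simp: c_def dest: dvd_mult_left)
    qed
    finally show ?thesis .
  qed
  have "0 < c" using k_pos o by (simp add: c_def)
  then show "dart x p \<in> orbit face_map (dart x p)" "card (orbit face_map (dart x p)) = c"
    using funpow_orbit_card[of face_map "dart x p" c, OF per] by simp_all
qed

lemma faces_card:
  assumes "F \<in> faces G rot" and nz: "\<And>p. \<not> v dvd cycle_sum k p"
  shows "k dvd card F" "k < card F" "prime w \<Longrightarrow> card F = k * w"
proof -
  obtain x p where x: "x \<in> {0..<v}" and F: "F = orbit face_map (dart x p)"
    using assms(1) unfolding faces_def by (metis (no_types, lifting) arc_dart imageE)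
  let ?g = "gcd v (cycle_sum k p)"
  have c: "card F = k * nat (v div ?g)" using face_orbit[OF x] F by simp
  then show "k dvd card F" by simp
  have v: "v = ?g * (v div ?g)" by simp
  have g: "?g > 0" using v_pos by simp
  then have pos: "0 < v div ?g" using v v_pos by (metis zero_less_mult_pos)
  have "v div ?g \<noteq> 1" using v nz[of p] by (metis gcd_dvd2 mult.right_neutral)
  then show "k < card F" using c k_pos pos by simp
  assume "prime w"
  then have "prime v" by simp
  then have "?g = 1 \<or> ?g = v" using g by (metis gcd_dvd1 gcd_pos_int prime_int_iff less_le)
  then have "?g = 1" using nz[of p] by (metis gcd_dvd2)
  then show "card F = k * w" using c by simp
qed

lemma faces_orbit_eq:
  assumes "F \<in> faces G rot" "a \<in> F" shows "F = orbit face_map a"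
proof -
  obtain x p where x: "x \<in> {0..<v}" and F: "F = orbit face_map (dart x p)"
    using assms(1) unfolding faces_def by (metis (no_types, lifting) arc_dart imageE)
  have "cyclic_on face_map F" unfolding F using face_orbit(1)[OF x] by (rule cyclic_on_singleI) simp
  then show ?thesis using assms(2) orbit_cyclic_eq3 by metis
qed

text \<open>A face is coloured by the common parity of its indices: \<open>\<iota>\<close> and the
  addition of 1 both change parity, so a face step preserves it. The two arcs of an edge have
  indices \<open>p\<close> and \<open>\<iota> p\<close>, hence lie on faces of different
  colours.\<close>

lemma biembedding_rot: "biembedding G rot"
  unfolding biembedding_def
proof (intro conjI embedding_rot exI ballI allI)
  define col where "col F \<longleftrightarrow> (\<exists>x p. x \<in> {0..<v} \<and> dart x p \<in> F \<and> even p)" for F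
  have even_cong: "even p \<longleftrightarrow> even q" if "p mod L = q mod L" for p q
    using that L_even by (metis dvd_mod_iff)
  have col: "col (orbit face_map (dart x p)) \<longleftrightarrow> even p" if x: "x \<in> {0..<v}" for x p
  proof
    assume "col (orbit face_map (dart x p))"
    then obtain y q where "dart y q \<in> orbit face_map (dart x p)" "even q" by (auto simp: col_def)
    then obtain j where "dart y q = (face_map ^^ j) (dart x p)" by (auto simp: orbit_altdef)
    then have "q mod L = (face_step ^^ j) p mod L" by (simp add: face_map_funpow[OF x] dart_eq)
    then show "even p" using \<open>even q\<close> even_cong face_step_funpow_parity by blast
  next
    assume "even p" then show "col (orbit face_map (dart x p))"
      using x face_orbit(1)[OF x] by (auto simp: col_def)
  qed
  fix a c assume "a \<in> parcs G"
  then obtain x p where x: "x \<in> {0..<v}" and a: "a = dart x p" by (rule arc_dart)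
  have sw: "prod.swap a = dart (nbr x p) (\<iota> p)" by (simp add: a dart_def nbr_iota[OF x])
  \<comment> \<open>The two arcs of the edge are ordered so that the first one lies on the face of
    colour \<open>c\<close>.\<close>
  obtain y q y' q' where y: "y \<in> {0..<v}" "even q = c" and y': "y' \<in> {0..<v}" "even q' = (\<not> c)"
    and aa: "{a, prod.swap a} = {dart y q, dart y' q'}"
  proof (cases "even p = c")
    case True
    then show ?thesis using x nbr_mem
      by (intro that[of x p "nbr x p" "\<iota> p"]) (simp_all add: a sw[unfolded a] iota_parity del: atLeastLessThan_iff)
  next
    case False
    then show ?thesis using x nbr_mem
      by (intro that[of "nbr x p" "\<iota> p" x p])
        (auto simp: a sw[unfolded a] iota_parity simp del: atLeastLessThan_iff)
  qed
  have on: "edge_on_face a F \<longleftrightarrow> dart y q \<in> F \<or> dart y' q' \<in> F" for F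
    using aa by (auto simp: edge_on_face_def doubleton_eq_iff)
  show "\<exists>!F. F \<in> faces G rot \<and> col F = c \<and> edge_on_face a F"
  proof (intro ex1I conjI)
    let ?F = "orbit face_map (dart y q)"
    show "?F \<in> faces G rot" unfolding faces_def by (rule imageI) (rule dart_arc[OF y(1)])
    show "col ?F = c" by (simp only: col[OF y(1)] y(2))
    show "edge_on_face a ?F" unfolding on by (rule disjI1) (rule face_orbit(1)[OF y(1)])
    fix F assume F: "F \<in> faces G rot \<and> col F = c \<and> edge_on_face a F"
    have "dart y' q' \<notin> F"
    proof
      assume "dart y' q' \<in> F"
      then have "F = orbit face_map (dart y' q')" using F faces_orbit_eq by simp
      then show False using F y'(2) by (simp only: col[OF y'(1)]) simp
    qed
    then have "dart y q \<in> F" using F unfolding on by simp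
    then show "F = ?F" using F by (intro faces_orbit_eq) simp_all
  qed
qed

end

section \<open>Two permutations with all cycles of equal length and cyclic product\<close>

text \<open>
  The points are the cells \<open>(i, j)\<close> with \<open>i\<close> modulo \<open>n\<close> and \<open>j\<close> modulo \<open>k\<close>. The row permutation is
  \<open>(i, j) \<mapsto> (i, j + 1)\<close>, the column permutation is \<open>(i, j) \<mapsto> (g\<^sub>j i, j + 1)\<close>, where
  \<open>g\<^sub>0 i = i - 1\<close>, \<open>g\<^sub>1 i = 2 i\<close>, \<open>g\<^sub>2 i = i / 2 + 1\<close> and all other \<open>g\<^sub>j\<close> are trivial. As
  \<open>g\<^sub>2 g\<^sub>1 g\<^sub>0 = 1\<close>, the columns have length \<open>k\<close>; as \<open>g\<^sub>1 g\<^sub>2 g\<^sub>0 i = i + 1\<close>, the product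
  \<open>(i, j) \<mapsto> (g\<^sub>j i, j + 2)\<close> is a single cycle. Cells are numbered along that
  cycle, starting with \<open>(0, 0)\<close>: the cell with number \<open>s\<close> has \<open>j = 2 s\<close> modulo \<open>k\<close> and \<open>i = fib s\<close>
  modulo \<open>n\<close>, while \<open>pt r i\<close> is the number of the cell with first coordinate \<open>i\<close> whose number is
  \<open>r\<close> modulo \<open>k\<close>. The cell with number \<open>s\<close> owns the index \<open>2 s\<close> and the index \<open>\<iota> (2 s)\<close>.
\<close>

locale tour =
  fixes n k :: int
  assumes n_pos: "0 < n" and n_odd: "odd n" and k_odd: "odd k" and k_ge: "3 \<le> k"
begin

text \<open>\<open>h\<close> and \<open>half\<close> are the inverses of 2 modulo \<open>k\<close>
  and modulo \<open>n\<close>. Since the cell with number \<open>s\<close> has second coordinate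
  \<open>2 * s\<close>, moving on by one in that coordinate adds \<open>h\<close> to the number
  modulo \<open>k\<close>.\<close>

definition "h = (k + 1) div 2"
definition "half = (n + 1) div 2"

text \<open>In round \<open>q\<close> the second coordinates appear in the order 0, 2, 4, ..., and 1
  is reached at \<open>r = h\<close>. So \<open>g\<^sub>0\<close>, \<open>g\<^sub>2\<close> and
  \<open>g\<^sub>1\<close> act on leaving \<open>r = 0\<close>, \<open>r = 1\<close> and
  \<open>r = h\<close>, which gives the four cases.\<close>

definition "fib s = (let r = s mod k; q = s div k in
  if r = 0 then q else if r = 1 then q - 1 else if r \<le> h then half * (q + 1) else q + 1)"

definition "unfib r i = (if r = 0 then i else if r = 1 then i + 1 else if r \<le> h then 2 * i - 1 else i - 1 :: int)"

definition "pt r i = k * (unfib r i mod n) + r"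

text \<open>An odd index is matched with the next cell of its row, an even index with the previous
  one. Hence a face step is the row permutation on odd indices; on even indices it goes back in the
  row and then forward on the tour, which is a conjugate of the column permutation.\<close>

definition "iota p = (if odd p then 2 * pt ((p div 2 + h) mod k) (fib (p div 2))
  else 2 * pt ((p div 2 - h) mod k) (fib (p div 2)) + 1)"

text \<open>
  For odd \<open>p\<close> this is the row of the cell, for even \<open>p\<close> its column.
\<close>

definition "invariant p = (let u = p div 2; r = u mod k in
  if odd p then fib u else if r = 1 then fib u + 1 else if r = (h + 1) mod k then half * fib u + 1 else fib u)"

lemma h_eq: "2 * h = k + 1" using k_odd unfolding h_def by presburger
lemma half_eq: "2 * half = n + 1" using n_odd unfolding half_def by presburger
lemma h_bounds: "2 \<le> h" "h < k" using h_eq k_ge by linarith+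

lemma half_twice: "[half * (2 * i) = i] (mod n)" "[2 * (half * i) = i] (mod n)"
proof -
  have "half * (2 * i) = (2 * half) * i" by simp
  also have "\<dots> = n * i + i" by (simp only: half_eq) algebra
  finally show "[half * (2 * i) = i] (mod n)" by (simp add: cong_def)
  then show "[2 * (half * i) = i] (mod n)" by (simp add: mult.left_commute)
qed

lemma half_mult_cong: "[a = 2 * b] (mod n) \<Longrightarrow> [half * a = b] (mod n)"
  using cong_mult[OF cong_refl[of half], of a "2 * b"] half_twice(1)[of b] cong_trans by blast

lemma unfib_fib: "[unfib (s mod k) (fib s) = s div k] (mod n)"
proof -
  have "[2 * (half * (s div k + 1)) - 1 = s div k] (mod n)"
    using cong_diff[OF half_twice(2)[of "s div k + 1"] cong_refl[of 1]] by simp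
  then show ?thesis by (auto simp: unfib_def fib_def Let_def)
qed

lemma unfib_cong: "[i = j] (mod n) \<Longrightarrow> [unfib r i = unfib r j] (mod n)"
  by (auto simp: unfib_def intro!: cong_add cong_diff cong_mult)

lemma pt_cong: "[i = j] (mod n) \<Longrightarrow> pt r i = pt r j"
  using unfib_cong[of i j r] by (simp add: pt_def cong_def)

lemma pt_mod_div:
  assumes "0 \<le> r" "r < k"
  shows "pt r i mod k = r" "pt r i div k = unfib r i mod n" "0 \<le> pt r i" "pt r i < k * n"
proof -
  show "pt r i mod k = r" "pt r i div k = unfib r i mod n" "0 \<le> pt r i"
    using assms n_pos by (auto simp: pt_def)
  have "unfib r i mod n \<le> n - 1" using pos_mod_bound[OF n_pos, of "unfib r i"] by linarith
  then have "k * (unfib r i mod n) \<le> k * (n - 1)" using k_ge by (intro mult_left_mono) auto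
  then show "pt r i < k * n" using assms by (simp add: pt_def algebra_simps)
qed

lemma fib_pt:
  assumes "0 \<le> r" "r < k"
  shows "[fib (pt r i) = i] (mod n)"
proof -
  have m: "[unfib r i mod n = unfib r i] (mod n)" by simp
  have 1: "[half * ((2 * i - 1) mod n + 1) = i] (mod n)"
    by (rule half_mult_cong) (simp add: cong_def mod_simps)
  show ?thesis using 1 assms
    by (auto simp: fib_def Let_def pt_mod_div unfib_def cong_def mod_simps)
qed

text \<open>Together with \<open>fib_pt\<close> this identifies numbers modulo \<open>k * n\<close>
  with cells: the tour is a single cycle through all of them.\<close>

lemma pt_fib: "pt (s mod k) (fib s) = s mod (k * n)"
proof -
  have "pt (s mod k) (fib s) = k * ((s div k) mod n) + s mod k"
    using unfib_fib[of s] by (simp add: pt_def cong_def)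
  also have "\<dots> = s mod (k * n)" using n_pos by (simp add: zmod_zmult2_eq)
  finally show ?thesis .
qed

lemma fib_inj: "[fib s = fib s'] (mod n) \<Longrightarrow> s mod k = s' mod k \<Longrightarrow> s mod (k * n) = s' mod (k * n)"
  by (metis pt_fib pt_cong)

lemma fib_mod: "[fib (s mod (k * n)) = fib s] (mod n)"
  using fib_pt[of "s mod k" "fib s"] k_ge by (simp add: pt_fib)

lemma fib_step: "[fib (s + 1) = (if s mod k = 0 then fib s - 1 else if s mod k = 1 then half * fib s + 1
  else if s mod k = h then 2 * fib s else fib s)] (mod n)"
proof -
  define q r where "q = s div k" and "r = s mod k"
  have r: "0 \<le> r" "r < k" using k_ge by (auto simp: r_def)
  have s: "s = k * q + r" by (simp add: q_def r_def)
  have next_: "(s + 1) mod k = (if r = k - 1 then 0 else r + 1)" "(s + 1) div k = (if r = k - 1 then q + 1 else q)"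
  proof -
    have "s + 1 = k * (if r = k - 1 then q + 1 else q) + (if r = k - 1 then 0 else r + 1)"
      by (auto simp: s algebra_simps)
    then show "(s + 1) mod k = (if r = k - 1 then 0 else r + 1)" "(s + 1) div k = (if r = k - 1 then q + 1 else q)"
      using r by (simp_all only:, auto)
  qed
  have a: "[half * (q + 1) = half * (q - 1) + 1] (mod n)"
  proof -
    have "half * (q + 1) - (half * (q - 1) + 1) = 2 * half - 1" by (simp add: algebra_simps)
    then show ?thesis by (simp add: half_eq cong_iff_dvd_diff)
  qed
  have b: "[q + 1 = 2 * (half * (q + 1))] (mod n)" using half_twice(2) cong_sym by blast
  show ?thesis using r h_bounds a b k_ge h_eq
    by (auto simp: fib_def Let_def next_ q_def[symmetric] r_def[symmetric])
qed

section \<open>The involution and the cycles of its face step\<close>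

lemma iota_range: "0 \<le> iota p" "iota p < 2 * k * n"
  using pt_mod_div(3,4)[of "(p div 2 + h) mod k" "fib (p div 2)"]
    pt_mod_div(3,4)[of "(p div 2 - h) mod k" "fib (p div 2)"] k_ge
  by (auto simp: iota_def)

lemma iota_parity: "even (iota p) \<longleftrightarrow> odd p"
  by (simp add: iota_def)

lemma div2_mod: "(p mod (2 * k * n)) div 2 = (p div 2) mod (k * n)"
proof -
  have "p mod (2 * (k * n)) = 2 * (p div 2 mod (k * n)) + p mod 2"
    using n_pos k_ge by (simp add: zmod_zmult2_eq)
  then show ?thesis by (simp add: mult.assoc)
qed

lemma iota_mod: "iota (p mod (2 * k * n)) = iota p"
proof -
  let ?s = "p div 2"
  have "(?s mod (k * n) + c) mod k = (?s + c) mod k" for c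
    by (metis dvd_triv_left mod_add_left_eq mod_mod_cancel)
  moreover have "(?s mod (k * n) - c) mod k = (?s - c) mod k" for c
    by (metis dvd_triv_left mod_diff_left_eq mod_mod_cancel)
  moreover have "even (p mod (2 * k * n)) \<longleftrightarrow> even p" by (simp add: dvd_mod_iff)
  ultimately show ?thesis using pt_cong[OF fib_mod] by (simp add: iota_def div2_mod)
qed

text \<open>Both cases keep the first coordinate and shift the number modulo \<open>k\<close> by
  \<open>h\<close> in opposite directions, so they undo each other.\<close>

lemma iota_iota: "iota (iota p) = p mod (2 * k * n)"
proof -
  let ?s = "p div 2"
  have b: "0 \<le> x mod k" "x mod k < k" for x using k_ge by auto
  have m1: "(pt (x mod k) i - h) mod k = (x - h) mod k" for x i
  proof -
    have "(pt (x mod k) i - h) mod k = (pt (x mod k) i mod k - h) mod k" by (rule mod_diff_left_eq[symmetric])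
    then show ?thesis by (simp only: pt_mod_div(1)[OF b] mod_diff_left_eq)
  qed
  have m2: "(pt (x mod k) i + h) mod k = (x + h) mod k" for x i
  proof -
    have "(pt (x mod k) i + h) mod k = (pt (x mod k) i mod k + h) mod k" by (rule mod_add_left_eq[symmetric])
    then show ?thesis by (simp only: pt_mod_div(1)[OF b] mod_add_left_eq)
  qed
  have pt: "pt r (fib (pt (x mod k) i)) = pt r i" for r x i by (rule pt_cong[OF fib_pt[OF b]])
  have "iota (iota p) = 2 * (?s mod (k * n)) + p mod 2"
  proof (cases "odd p")
    case True
    then have "iota p = 2 * pt ((?s + h) mod k) (fib ?s)" by (simp add: iota_def)
    then have "iota (iota p) = 2 * pt ((pt ((?s + h) mod k) (fib ?s) - h) mod k) (fib (pt ((?s + h) mod k) (fib ?s))) + 1"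
      by (simp add: iota_def)
    also have "\<dots> = 2 * pt (?s mod k) (fib ?s) + 1" by (simp only: m1 pt add_diff_cancel_right')
    finally show ?thesis using True by (simp add: pt_fib odd_iff_mod_2_eq_one)
  next
    case False
    then have "iota p = 2 * pt ((?s - h) mod k) (fib ?s) + 1" by (simp add: iota_def)
    then have "iota (iota p) = 2 * pt ((pt ((?s - h) mod k) (fib ?s) + h) mod k) (fib (pt ((?s - h) mod k) (fib ?s)))"
      by (simp add: iota_def)
    also have "\<dots> = 2 * pt (?s mod k) (fib ?s)" by (simp only: m2 pt diff_add_cancel)
    finally show ?thesis using False by (simp add: pt_fib)
  qed
  also have "\<dots> = p mod (2 * (k * n))" using n_pos k_ge by (simp add: zmod_zmult2_eq)
  finally show ?thesis by (simp add: mult.assoc)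
qed

text \<open>This is \<open>2 * h = k + 1\<close> in disguise. Consequently a face step adds
  \<open>k + 1\<close> modulo \<open>2 * k\<close>, an element of order \<open>k\<close>.\<close>

lemma iota_mod_2k: "[iota p = p + k] (mod 2 * k)"
proof -
  let ?s = "p div 2"
  have b: "0 \<le> x mod k" "x mod k < k" for x using k_ge by auto
  have d: "[2 * pt (x mod k) i = 2 * x] (mod 2 * k)" for x i
    using pt_mod_div(1)[OF b, of x i] by (simp add: cong_def mult_mod_right[symmetric])
  show ?thesis
  proof (cases "odd p")
    case True
    then have "2 * (?s + h) = p + k" using h_eq by (auto elim: oddE)
    then show ?thesis using d[of "?s + h" "fib ?s"] True by (simp add: iota_def)
  next
    case False
    then have "2 * (?s - h) + 1 = p - k" using h_eq by (auto elim: evenE)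
    then have "[iota p = p - k] (mod 2 * k)"
      using cong_add[OF d[of "?s - h" "fib ?s"] cong_refl[of 1]] False by (simp add: iota_def)
    moreover have "[p - k = p + k] (mod 2 * k)" by (simp add: cong_iff_dvd_diff)
    ultimately show ?thesis by (rule cong_trans)
  qed
qed

text \<open>An odd index moves inside its row. From an even index the step passes to the previous
  cell \<open>s\<close> of the row and then along the tour, which applies one of the maps
  \<open>g\<^sub>j\<close>; the corrections in \<open>invariant\<close> compensate for it.\<close>

lemma invariant_step: "[invariant (iota p + 1) = invariant p] (mod n)"
proof (cases "odd p")
  case True
  have b: "0 \<le> x mod k" "x mod k < k" for x using k_ge by auto
  show ?thesis using True fib_pt[OF b] by (simp add: invariant_def iota_def Let_def)
next
  case False
  define u where "u = p div 2"
  define s where "s = pt ((u - h) mod k) (fib u)"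
  have b: "0 \<le> x mod k" "x mod k < k" for x using k_ge by auto
  have io: "iota p + 1 = 2 * (s + 1)" using False by (simp add: iota_def u_def s_def)
  have fs: "[fib s = fib u] (mod n)" unfolding s_def by (rule fib_pt[OF b])
  have ms: "s mod k = (u - h) mod k" unfolding s_def by (rule pt_mod_div[OF b])
  have mu: "u mod k = (s mod k + h) mod k" by (simp add: ms mod_simps)
  define r where "r = s mod k"
  have r: "0 \<le> r" "r < k" using k_ge by (auto simp: r_def)
  have rs: "(s + 1) mod k = (r + 1) mod k" by (simp add: r_def mod_simps)
  have k1: "1 mod k = 1" using k_ge by simp
  have eq: "x = y" if "k dvd x - y" "0 \<le> x" "x < k" "0 \<le> y" "y < k" for x y
    using that by (metis mod_eq_dvd_iff mod_pos_pos_trivial)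
  \<comment> \<open>E1 to E4 express the special residues of \<open>s + 1\<close> and of
    \<open>u\<close> through the residue \<open>r\<close> of \<open>s\<close>; E3 and E4 arise from
    \<open>u = s + h\<close> modulo \<open>k\<close>.\<close>
  have E1: "(r + 1) mod k = 1 \<longleftrightarrow> r = 0"
  proof -
    have "(r + 1) mod k = 1 mod k \<longleftrightarrow> k dvd r - 0" by (simp add: mod_eq_dvd_iff)
    then show ?thesis using eq[of r 0] r k_ge by (auto simp: k1)
  qed
  have E2: "(r + 1) mod k = (h + 1) mod k \<longleftrightarrow> r = h"
  proof -
    have "(r + 1) mod k = (h + 1) mod k \<longleftrightarrow> k dvd r - h" by (simp add: mod_eq_dvd_iff)
    then show ?thesis using eq[of r h] r h_bounds by auto
  qed
  have E3: "(r + h) mod k = 1 \<longleftrightarrow> r = h"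
  proof -
    have "(r + h) mod k = 1 mod k \<longleftrightarrow> k dvd r + h - 1" by (simp only: mod_eq_dvd_iff)
    also have "r + h - 1 = r - h + k" using h_eq by simp
    finally show ?thesis using eq[of r h] r h_bounds by (auto simp: k1)
  qed
  have E4: "(r + h) mod k = (h + 1) mod k \<longleftrightarrow> r = 1"
  proof -
    have "(r + h) mod k = (h + 1) mod k \<longleftrightarrow> k dvd r - 1" by (simp add: mod_eq_dvd_iff)
    then show ?thesis using eq[of r 1] r k_ge by auto
  qed
  have st: "[fib (s + 1) = (if r = 0 then fib u - 1 else if r = 1 then half * fib u + 1
      else if r = h then 2 * fib u else fib u)] (mod n)"
  proof -
    have "[fib s - 1 = fib u - 1] (mod n)" "[half * fib s + 1 = half * fib u + 1] (mod n)"
      "[2 * fib s = 2 * fib u] (mod n)"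
      using fs by (simp_all add: cong_diff cong_add cong_mult)
    then show ?thesis using fs
      by (intro cong_trans[OF fib_step[of s, folded r_def]]) simp
  qed
  have c1: "[fib (s + 1) = fib u - 1] (mod n) \<Longrightarrow> [fib (s + 1) + 1 = fib u] (mod n)"
    using cong_add[OF _ cong_refl[of 1], of "fib (s + 1)" "fib u - 1"] by simp
  have c2: "[fib (s + 1) = 2 * fib u] (mod n) \<Longrightarrow> [half * fib (s + 1) + 1 = fib u + 1] (mod n)"
    by (rule cong_add[OF half_mult_cong cong_refl])
  have i1: "invariant (iota p + 1) = (if r = 0 then fib (s + 1) + 1 else
      if r = h then half * fib (s + 1) + 1 else fib (s + 1))"
    by (simp add: invariant_def Let_def io rs E1 E2)
  have i2: "invariant p = (if r = h then fib u + 1 else if r = 1 then half * fib u + 1 else fib u)"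
    using False by (simp add: invariant_def Let_def u_def[symmetric] mu r_def[symmetric] E3 E4)
  show ?thesis unfolding i1 i2
  proof (cases "r = h")
    case True
    then show "[(if r = 0 then fib (s + 1) + 1 else if r = h then half * fib (s + 1) + 1 else fib (s + 1)) =
      (if r = h then fib u + 1 else if r = 1 then half * fib u + 1 else fib u)] (mod n)"
      using st c2 h_bounds by simp
  next
    case False
    then show "[(if r = 0 then fib (s + 1) + 1 else if r = h then half * fib (s + 1) + 1 else fib (s + 1)) =
      (if r = h then fib u + 1 else if r = 1 then half * fib u + 1 else fib u)] (mod n)"
      using st c1 by (auto split: if_splits)
  qed
qed

abbreviation "step p \<equiv> iota p + 1"

lemma step_funpow_mod_2k: "[(step ^^ j) p = p + int j * (k + 1)] (mod 2 * k)"
proof (induction j)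
  case (Suc j)
  have "[step ((step ^^ j) p) = (step ^^ j) p + k + 1] (mod 2 * k)"
    by (rule cong_add[OF iota_mod_2k cong_refl])
  also have "[(step ^^ j) p + k + 1 = p + int j * (k + 1) + k + 1] (mod 2 * k)"
    by (intro cong_add[OF _ cong_refl] Suc)
  finally show ?case by (simp add: algebra_simps)
qed simp

lemma step_funpow_invariant: "[invariant ((step ^^ j) p) = invariant p] (mod n)"
  by (induction j) (auto intro: cong_trans[OF invariant_step])

text \<open>The residue modulo \<open>2 * k\<close> fixes the parity and the second coordinate; for
  these fixed, \<open>invariant\<close> is an injective function of the first coordinate.\<close>

lemma position_determined:
  assumes 1: "[p = q] (mod 2 * k)" and 2: "[invariant p = invariant q] (mod n)"
  shows "p mod (2 * k * n) = q mod (2 * k * n)"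
proof -
  obtain c where c: "p = q + 2 * k * c" using 1 by (metis cong_iff_lin cong_sym mult.assoc)
  then have par: "odd p \<longleftrightarrow> odd q" by auto
  then have par2: "p mod 2 = q mod 2" by presburger
  have "p div 2 = q div 2 + k * c" using c by simp
  then have m: "p div 2 mod k = q div 2 mod k" by simp
  have 3: "[a = b] (mod n)" if "[half * a = half * b] (mod n)" for a b
    using cong_mult[OF cong_refl[of 2] that] half_twice(2) by (meson cong_sym cong_trans)
  have "[fib (p div 2) = fib (q div 2)] (mod n)"
  proof (cases "odd q")
    case True
    then show ?thesis using 2 par by (simp add: invariant_def Let_def)
  next
    case False
    then have 4: "[(if q div 2 mod k = 1 then fib (p div 2) + 1
        else if q div 2 mod k = (h + 1) mod k then half * fib (p div 2) + 1 else fib (p div 2)) =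
      (if q div 2 mod k = 1 then fib (q div 2) + 1
        else if q div 2 mod k = (h + 1) mod k then half * fib (q div 2) + 1 else fib (q div 2))] (mod n)"
      using 2 par by (simp only: invariant_def Let_def m if_False)
    consider "q div 2 mod k = 1" | "q div 2 mod k \<noteq> 1" "q div 2 mod k = (h + 1) mod k"
      | "q div 2 mod k \<noteq> 1" "q div 2 mod k \<noteq> (h + 1) mod k" by blast
    then show ?thesis
    proof cases
      case 1
      then show ?thesis using 4 by (simp only: if_True refl simp_thms cong_add_rcancel)
    next
      case 2
      then have "[half * fib (p div 2) = half * fib (q div 2)] (mod n)"
        using 4 by (simp only: if_True if_False refl simp_thms cong_add_rcancel)
      then show ?thesis by (rule 3)
    next
      case 3
      then show ?thesis using 4 by (simp only: if_False)
    qed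
  qed
  then have e: "p div 2 mod (k * n) = q div 2 mod (k * n)" using m by (rule fib_inj)
  have "x mod (2 * (k * n)) = 2 * (x div 2 mod (k * n)) + x mod 2" for x
    using n_pos k_ge by (intro zmod_zmult2_eq) simp
  then show ?thesis by (simp only: e par2 mult.assoc)
qed

text \<open>Modulo \<open>2 * k\<close> the iterate adds \<open>2 * h * j\<close>, and
  \<open>h\<close> is coprime to \<open>k\<close>, so a return forces \<open>k dvd j\<close>.
  Conversely, a return modulo \<open>2 * k\<close> is a full return by the invariant.\<close>

lemma step_period: "(step ^^ j) p mod (2 * k * n) = p mod (2 * k * n) \<longleftrightarrow> k dvd int j"
proof
  assume "(step ^^ j) p mod (2 * k * n) = p mod (2 * k * n)"
  then have "[(step ^^ j) p = p] (mod 2 * k * n)" by (simp only: cong_def)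
  then have "[(step ^^ j) p = p] (mod 2 * k)" by (rule cong_dvd_modulus) simp
  then have "[p + int j * (k + 1) = p] (mod 2 * k)"
    by (rule cong_trans[OF cong_sym[OF step_funpow_mod_2k]])
  then have "2 * k dvd int j * (2 * h)" unfolding cong_iff_dvd_diff h_eq by (simp only: add_diff_cancel_left')
  then have "2 * k dvd 2 * (int j * h)" by (simp only: mult.left_commute)
  then have "k dvd int j * h" unfolding dvd_mult_cancel_left by simp
  moreover have "coprime k h"
  proof (rule coprimeI)
    fix c assume "c dvd k" "c dvd h"
    then have "c dvd 2 * h - k" by simp
    then show "is_unit c" by (simp add: h_eq)
  qed
  ultimately show "k dvd int j" by (simp add: coprime_dvd_mult_left_iff)
next
  assume "k dvd int j"
  then have "2 * k dvd 2 * (int j * h)" by (intro mult_dvd_mono) auto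
  then have "2 * k dvd int j * (2 * h)" by (simp only: mult.left_commute)
  then have "[p + int j * (k + 1) = p] (mod 2 * k)"
    unfolding cong_iff_dvd_diff h_eq by (simp only: add_diff_cancel_left')
  then have "[(step ^^ j) p = p] (mod 2 * k)" by (rule cong_trans[OF step_funpow_mod_2k])
  then show "(step ^^ j) p mod (2 * k * n) = p mod (2 * k * n)"
    using step_funpow_invariant by (rule position_determined)
qed

section \<open>Representatives of the face cycles and explicit values\<close>

definition "reps = (\<lambda>i. 2 * k * i) ` {0..<n} \<union> (\<lambda>i. 2 * k * i + 1) ` {0..<n}"

lemma card_reps: "finite reps" "card reps \<le> 2 * nat n"
proof -
  show "finite reps" by (simp add: reps_def)
  have "card reps \<le> card ((\<lambda>i. 2 * k * i) ` {0..<n}) + card ((\<lambda>i. 2 * k * i + 1) ` {0..<n})"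
    unfolding reps_def by (rule card_Un_le)
  also have "\<dots> \<le> card {0..<n} + card {0..<n}" by (intro add_mono card_image_le) auto
  finally show "card reps \<le> 2 * nat n" by simp
qed

text \<open>As a face step adds \<open>k + 1\<close> modulo \<open>2 * k\<close>, each cycle runs
  through all residues of its parity and therefore meets 0 or 1.\<close>

lemma reach_rep: "\<exists>j. (step ^^ j) p mod (2 * k * n) \<in> reps"
proof -
  define b where "b = p mod 2"
  \<comment> \<open>This \<open>j\<close> is even, so \<open>j * k\<close> vanishes modulo
    \<open>2 * k\<close> and \<open>j * (k + 1)\<close> agrees with \<open>j\<close>.\<close>
  define j where "j = nat ((b - p) mod (2 * k))"
  have j: "int j = (b - p) mod (2 * k)" using k_ge by (simp add: j_def)
  have b: "b = 0 \<or> b = 1" by (auto simp: b_def)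
  have "even (b - p)" by (simp add: b_def)
  then have "even (int j)" unfolding j by (simp add: dvd_mod_iff)
  then have "2 * k dvd int j * k" by simp
  moreover have "2 * k dvd p + int j - b"
  proof -
    have "(p + int j - b) mod (2 * k) = (p + (b - p) - b) mod (2 * k)" unfolding j
      by (metis mod_add_right_eq mod_diff_left_eq)
    then show ?thesis by (simp add: dvd_eq_mod_eq_0)
  qed
  ultimately have "2 * k dvd (p + int j - b) + int j * k" by simp
  then have "[p + int j * (k + 1) = b] (mod 2 * k)" by (simp add: cong_iff_dvd_diff algebra_simps)
  then have s: "[(step ^^ j) p = b] (mod 2 * k)" by (rule cong_trans[OF step_funpow_mod_2k])
  define x where "x = (step ^^ j) p mod (2 * k * n)"
  have "x mod (2 * k) = b mod (2 * k)" using s by (simp add: x_def cong_def mod_mod_cancel)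
  also have "\<dots> = b" using b k_ge by auto
  finally have x: "x = 2 * k * (x div (2 * k)) + b" by (metis mult_div_mod_eq)
  have "0 \<le> x" "x < (2 * k) * n" using n_pos k_ge by (auto simp: x_def)
  then have "(2 * k) * (x div (2 * k)) < (2 * k) * n" using x b by linarith
  then have "x div (2 * k) < n" using k_ge by (simp only: mult_less_cancel_left_pos)
  moreover have "0 \<le> x div (2 * k)" using \<open>0 \<le> x\<close> k_ge by (simp add: pos_imp_zdiv_nonneg_iff)
  ultimately have "x div (2 * k) \<in> {0..<n}" by simp
  then have "x \<in> reps" using x b unfolding reps_def by auto
  then show ?thesis unfolding x_def ..
qed

text \<open>The cell numbered \<open>k * x\<close> is \<open>(x, 0)\<close>; its successor in the
  row has residue \<open>h\<close>, where \<open>unfib\<close> doubles. The result is linear in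
  \<open>x\<close>, which makes the marked indices explicit.\<close>

lemma iota_special: "iota (2 * k * x + 1) = (4 * k * x - k + 1) mod (2 * k * n)"
proof -
  have "(2 * k * x + 1) div 2 = k * x" by simp
  then have "iota (2 * k * x + 1) = 2 * pt h x"
    using k_ge h_bounds by (simp add: iota_def fib_def Let_def)
  also have "\<dots> = 2 * k * ((2 * x - 1) mod n) + (k + 1)"
    using h_bounds h_eq by (simp add: pt_def unfib_def algebra_simps)
  also have "\<dots> = (2 * k * ((2 * x - 1) mod n) + (k + 1)) mod (2 * k * n)"
    using calculation iota_range by (metis mod_pos_pos_trivial)
  also have "\<dots> = ((2 * k * (2 * x - 1)) mod (2 * k * n) + (k + 1)) mod (2 * k * n)"
    by (simp only: mult_mod_right)
  also have "\<dots> = (2 * k * (2 * x - 1) + (k + 1)) mod (2 * k * n)" by (rule mod_add_left_eq)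
  also have "2 * k * (2 * x - 1) + (k + 1) = 4 * k * x - k + 1" by (simp add: algebra_simps)
  finally show ?thesis .
qed

lemma step_funpow_cong:
  "p mod (2 * k * n) = q mod (2 * k * n) \<Longrightarrow> (step ^^ j) p mod (2 * k * n) = (step ^^ j) q mod (2 * k * n)"
proof (induction j)
  case (Suc j)
  then have "iota ((step ^^ j) p) = iota ((step ^^ j) q)" by (metis iota_mod)
  then show ?case by simp
qed simp

lemma step_funpow_distinct:
  assumes "i < j" "int j < k"
  shows "(step ^^ i) p mod (2 * k * n) \<noteq> (step ^^ j) p mod (2 * k * n)"
proof
  assume e: "(step ^^ i) p mod (2 * k * n) = (step ^^ j) p mod (2 * k * n)"
  define l where "l = nat k - j"
  have "(step ^^ (l + i)) p mod (2 * k * n) = (step ^^ (l + j)) p mod (2 * k * n)"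
    using step_funpow_cong[OF e, of l] by (simp only: funpow_add o_apply)
  also have "\<dots> = p mod (2 * k * n)" unfolding step_period using assms by (simp add: l_def)
  finally have "k dvd int (l + i)" unfolding step_period .
  then show False using assms zdvd_imp_le[of k "int (l + i)"] by (simp add: l_def)
qed

lemma step_funpow_parity: "even ((step ^^ j) p) \<longleftrightarrow> even p"
  by (induction j) (auto simp: iota_parity)

end

section \<open>Indices of the prescribed values\<close>

text \<open>The base 5 digits of both sides are at most 3, so there is no carry and the lowest digit
  tells which exponents vanish. The next lemma is the same with digits at most 2.\<close>

lemma power5_weighted_eq:
  "2 * 5 ^ a + 5 ^ b = 2 * 5 ^ c + (5 ^ d :: int) \<Longrightarrow> a = c \<and> b = d"
proof (induction a arbitrary: b c d)
  case 0
  have m: "(2 * 5 ^ a + 5 ^ b :: int) mod 5 = (if a = 0 then 2 else 0) + (if b = 0 then 1 else 0)" for a b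
    by (cases a; cases b) (auto simp: mod_add_eq[symmetric])
  have "c = 0" using arg_cong[OF 0, of "\<lambda>x. x mod 5"] unfolding m by (auto split: if_splits)
  then show ?case using 0 by simp
next
  case (Suc a)
  have m: "(2 * 5 ^ a + 5 ^ b :: int) mod 5 = (if a = 0 then 2 else 0) + (if b = 0 then 1 else 0)" for a b
    by (cases a; cases b) (auto simp: mod_add_eq[symmetric])
  have c: "c \<noteq> 0" and bd: "b = 0 \<longleftrightarrow> d = 0"
    using arg_cong[OF Suc.prems, of "\<lambda>x. x mod 5"] unfolding m by (auto split: if_splits)
  then obtain c' where c': "c = Suc c'" using not0_implies_Suc by blast
  show ?case
  proof (cases b)
    case 0
    then show ?thesis using Suc.prems bd c' by simp
  next
    case (Suc b')
    then obtain d' where "d = Suc d'" using bd not0_implies_Suc by blast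
    then show ?thesis using Suc.IH[of b' c' d'] Suc.prems Suc c' by simp
  qed
qed

lemma power5_sum_eq:
  "5 ^ a + 5 ^ b = 5 ^ c + (5 ^ d :: int) \<Longrightarrow> a = c \<and> b = d \<or> a = d \<and> b = c"
proof (induction a arbitrary: b c d)
  case 0
  have m: "(5 ^ a + 5 ^ b :: int) mod 5 = (if a = 0 then 1 else 0) + (if b = 0 then 1 else 0)" for a b
    by (cases a; cases b) (auto simp: mod_add_eq[symmetric])
  have "c = 0 \<or> d = 0" using arg_cong[OF 0, of "\<lambda>x. x mod 5"] unfolding m by (auto split: if_splits)
  then show ?case using 0 by auto
next
  case (Suc a)
  have m: "(5 ^ a + 5 ^ b :: int) mod 5 = (if a = 0 then 1 else 0) + (if b = 0 then 1 else 0)" for a b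
    by (cases a; cases b) (auto simp: mod_add_eq[symmetric])
  have z: "b = 0 \<longleftrightarrow> c = 0 \<or> d = 0" "\<not> (c = 0 \<and> d = 0)"
    using arg_cong[OF Suc.prems, of "\<lambda>x. x mod 5"] unfolding m by (auto split: if_splits)
  show ?case
  proof (cases b)
    case 0
    have inj: "x = y" if "(5::int) ^ x = 5 ^ y" for x y using that by simp
    from 0 z consider "c = 0" | "d = 0" by blast
    then show ?thesis
    proof cases
      case 1
      then have "(5::int) ^ Suc a = 5 ^ d" using Suc.prems 0 by simp
      then show ?thesis using inj 0 1 by blast
    next
      case 2
      then have "(5::int) ^ Suc a = 5 ^ c" using Suc.prems 0 by simp
      then show ?thesis using inj 0 2 by blast
    qed
  next
    case (Suc b')
    then obtain c' d' where "c = Suc c'" "d = Suc d'" using z not0_implies_Suc by blast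
    then show ?thesis using Suc.IH[of b' c' d'] Suc.prems Suc by simp
  qed
qed

locale large_tour = tour +
  assumes n_large: "5 ^ 18 < n"
begin

abbreviation "L \<equiv> 2 * k * n"

text \<open>
  \<open>mark j\<close> and \<open>comark j\<close> are the two indices of a cell of the row \<open>5 ^ j\<close>. Powers of 5 are used
  because their sums \<open>x + y\<close> and \<open>2 x + y\<close> determine the summands, so that a nontrivial
  \<open>p \<mapsto> \<epsilon> p + i\<close> hardly ever maps marked indices to marked indices.
\<close>

definition "mark j = 4 * k * 5 ^ j - k + (1::int)"
definition "comark j = 2 * k * 5 ^ j + (1::int)"

definition "marked p \<longleftrightarrow> (\<exists>j<17::nat. [p = mark j] (mod L) \<or> [p = comark j] (mod L))"

text \<open>The expressions below combine powers of 5 with total weight at most 6, so the factor 8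
  turns congruences modulo \<open>n\<close> into equations.\<close>

lemma power5_bounds: "j < 17 \<Longrightarrow> 0 < (5::int) ^ j \<and> 8 * 5 ^ j < n"
proof -
  assume "j < (17::nat)"
  then have "(5::int) ^ j \<le> 5 ^ 16" by (intro power_increasing) auto
  then show ?thesis using n_large by simp
qed

lemma n_dvd_small: "n dvd x \<Longrightarrow> \<bar>x\<bar> < n \<Longrightarrow> x = 0"
  using dvd_imp_le_int[of x n] n_pos by linarith

lemma not_dvd_k: "\<not> 2 * k dvd k" "\<not> 2 * k dvd - k"
  using k_ge by (auto dest!: zdvd_imp_le)

lemma n_dvd_twice: "n dvd 2 * x \<Longrightarrow> n dvd x"
  using n_odd by (simp add: coprime_dvd_mult_right_iff coprime_commute)

lemma mark_cong: "[mark i = mark j] (mod L) \<Longrightarrow> i < 17 \<Longrightarrow> j < 17 \<Longrightarrow> i = j"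
proof -
  assume "[mark i = mark j] (mod L)" and ij: "i < 17" "j < 17"
  then have "L dvd mark i - mark j" by (simp only: cong_iff_dvd_diff)
  also have "mark i - mark j = 2 * k * (2 * (5 ^ i - 5 ^ j))" by (simp add: mark_def algebra_simps)
  finally have "n dvd 2 * (5 ^ i - 5 ^ j)" using k_ge by simp
  then have "n dvd 5 ^ i - 5 ^ j" by (rule n_dvd_twice)
  then have "(5::int) ^ i - 5 ^ j = 0" by (rule n_dvd_small) (use power5_bounds[OF ij(1)] power5_bounds[OF ij(2)] in linarith)
  then show "i = j" by simp
qed

text \<open>The images of two marks agree modulo \<open>2 * k\<close>, whereas marks and comarks
  differ there by \<open>k\<close>.\<close>

lemma marks_hit_same_type:
  assumes "\<epsilon> \<in> {1, - 1}" and "[\<epsilon> * mark a + i = mark x] (mod L)" "[\<epsilon> * mark b + i = comark y] (mod L)"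
  shows False
proof -
  have "L dvd ((\<epsilon> * mark a + i) - mark x) - ((\<epsilon> * mark b + i) - comark y)"
    using assms(2,3) unfolding cong_iff_dvd_diff by (rule dvd_diff)
  then have "2 * k dvd ((\<epsilon> * mark a + i) - mark x) - ((\<epsilon> * mark b + i) - comark y)"
    by (rule dvd_mult_left)
  also have "\<dots> = 2 * k * (2 * \<epsilon> * (5 ^ a - 5 ^ b) - 2 * 5 ^ x + 5 ^ y) + k"
    by (simp add: mark_def comark_def algebra_simps)
  finally show False using not_dvd_k by (simp add: dvd_add_right_iff)
qed

lemma marks_hit_marks:
  assumes "\<epsilon> \<in> {1, - 1}" and "[\<epsilon> * mark a + i = mark x] (mod L)" "[\<epsilon> * mark b + i = mark y] (mod L)"
    and "a < 17" "b < 17" "x < 17" "y < 17"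
  shows "\<epsilon> * 5 ^ a - 5 ^ x = \<epsilon> * 5 ^ b - (5 ^ y :: int)"
proof -
  have "L dvd ((\<epsilon> * mark a + i) - mark x) - ((\<epsilon> * mark b + i) - mark y)"
    using assms(2,3) unfolding cong_iff_dvd_diff by (rule dvd_diff)
  also have "\<dots> = 2 * k * (2 * ((\<epsilon> * 5 ^ a - 5 ^ x) - (\<epsilon> * 5 ^ b - 5 ^ y)))"
    by (simp add: mark_def algebra_simps)
  finally have "n dvd 2 * ((\<epsilon> * 5 ^ a - 5 ^ x) - (\<epsilon> * 5 ^ b - 5 ^ y))" using k_ge by simp
  then have "n dvd (\<epsilon> * 5 ^ a - 5 ^ x) - (\<epsilon> * 5 ^ b - 5 ^ y)" by (rule n_dvd_twice)
  then have "(\<epsilon> * 5 ^ a - 5 ^ x) - (\<epsilon> * 5 ^ b - 5 ^ y) = 0"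
  proof (rule n_dvd_small)
    have "\<epsilon> = 1 \<or> \<epsilon> = - 1" using assms(1) by simp
    then show "\<bar>(\<epsilon> * 5 ^ a - 5 ^ x) - (\<epsilon> * 5 ^ b - 5 ^ y)\<bar> < n"
      using power5_bounds[OF assms(4)] power5_bounds[OF assms(5)]
        power5_bounds[OF assms(6)] power5_bounds[OF assms(7)]
      by (elim disjE) (hypsubst, linarith)+
  qed
  then show ?thesis by simp
qed

text \<open>At most one mark is sent to a comark, because the weights 2 and 1 make the two powers of
  5 distinguishable.\<close>

lemma marks_hit_comarks:
  assumes "\<epsilon> \<in> {1, - 1}" and "[\<epsilon> * mark a + i = comark x] (mod L)" "[\<epsilon> * mark b + i = comark y] (mod L)"
    and "a < 17" "b < 17" "x < 17" "y < 17"
  shows "a = b"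
proof -
  have "L dvd ((\<epsilon> * mark a + i) - comark x) - ((\<epsilon> * mark b + i) - comark y)"
    using assms(2,3) unfolding cong_iff_dvd_diff by (rule dvd_diff)
  also have "\<dots> = 2 * k * ((\<epsilon> * (2 * 5 ^ a) - 5 ^ x) - (\<epsilon> * (2 * 5 ^ b) - 5 ^ y))"
    by (simp add: mark_def comark_def algebra_simps)
  finally have "n dvd (\<epsilon> * (2 * 5 ^ a) - 5 ^ x) - (\<epsilon> * (2 * 5 ^ b) - 5 ^ y)" using k_ge by simp
  then have "(\<epsilon> * (2 * 5 ^ a) - 5 ^ x) - (\<epsilon> * (2 * 5 ^ b) - 5 ^ y) = 0"
  proof (rule n_dvd_small)
    have "\<epsilon> = 1 \<or> \<epsilon> = - 1" using assms(1) by simp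
    then show "\<bar>(\<epsilon> * (2 * 5 ^ a) - 5 ^ x) - (\<epsilon> * (2 * 5 ^ b) - 5 ^ y)\<bar> < n"
      using power5_bounds[OF assms(4)] power5_bounds[OF assms(5)]
        power5_bounds[OF assms(6)] power5_bounds[OF assms(7)]
      by (elim disjE) (hypsubst, linarith)+
  qed
  then consider "2 * 5 ^ a + 5 ^ y = 2 * 5 ^ b + (5 ^ x :: int)" | "2 * 5 ^ a + 5 ^ x = 2 * 5 ^ b + (5 ^ y :: int)"
    using assms(1) by auto
  then show ?thesis using power5_weighted_eq by cases blast+
qed

text \<open>Comarks can be hit once at most. If marks are hit and \<epsilon> is 1, two hits would
  force a mark to be fixed, hence \<open>L dvd i\<close>. If \<epsilon> is -1, the sum of the power
  of 5 and its image power is constant, which leaves only one unordered pair of exponents and so at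
  most two hits.\<close>

lemma marked_hits:
  assumes eps: "\<epsilon> \<in> {1, - 1}" and nontriv: "\<not> (\<epsilon> = 1 \<and> L dvd i)"
  shows "card {l \<in> {9..<17}. marked (\<epsilon> * mark l + i)} \<le> 2"
proof (rule ccontr)
  let ?M = "{l \<in> {9..<17::nat}. marked (\<epsilon> * mark l + i)}"
  assume "\<not> card ?M \<le> 2"
  then have "3 \<le> card ?M" by simp
  then obtain T where T: "T \<subseteq> ?M" "card T = 3" by (rule obtain_subset_with_card_n)
  then obtain a b c where abc: "a \<in> ?M" "b \<in> ?M" "c \<in> ?M" "a \<noteq> b" "a \<noteq> c" "b \<noteq> c"
    by (auto simp: card_3_iff)
  have hit: "(\<exists>x<17. [\<epsilon> * mark l + i = mark x] (mod L)) \<or> (\<exists>x<17. [\<epsilon> * mark l + i = comark x] (mod L))"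
    if "l \<in> ?M" for l using that by (auto simp: marked_def)
  have lt: "a < 17" "b < 17" "c < 17" using abc by auto
  show False
  proof (cases "\<exists>x<17. [\<epsilon> * mark a + i = comark x] (mod L)")
    case True
    then obtain x where x: "x < 17" "[\<epsilon> * mark a + i = comark x] (mod L)" by blast
    obtain y where "y < 17" "[\<epsilon> * mark b + i = comark y] (mod L)"
      using hit[OF abc(2)] marks_hit_same_type[OF eps _ x(2)] by blast
    then have "a = b" using marks_hit_comarks[OF eps x(2) _ lt(1,2) x(1)] by blast
    then show False using abc by blast
  next
    case False
    then obtain x where x: "x < 17" "[\<epsilon> * mark a + i = mark x] (mod L)" using hit[OF abc(1)] by blast
    have E: "\<exists>y<17. \<epsilon> * 5 ^ a - 5 ^ x = \<epsilon> * 5 ^ l - (5 ^ y :: int)" if l: "l \<in> ?M" "l < 17" for l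
    proof -
      obtain y where "y < 17" "[\<epsilon> * mark l + i = mark y] (mod L)"
        using hit[OF l(1)] marks_hit_same_type[OF eps x(2)] by blast
      then show ?thesis using marks_hit_marks[OF eps x(2) _ lt(1) l(2) x(1)] by blast
    qed
    obtain y where y: "\<epsilon> * 5 ^ a - 5 ^ x = \<epsilon> * 5 ^ b - (5 ^ y :: int)" using E[OF abc(2) lt(2)] by blast
    obtain z where z: "\<epsilon> * 5 ^ a - 5 ^ x = \<epsilon> * 5 ^ c - (5 ^ z :: int)" using E[OF abc(3) lt(3)] by blast
    show False
    proof (cases "\<epsilon> = 1")
      case True
      then have "5 ^ a + 5 ^ y = 5 ^ b + (5 ^ x :: int)" using y by simp
      then have "x = a" using power5_sum_eq abc(4) by blast
      then have "L dvd i" using x(2) True by (simp add: cong_iff_dvd_diff)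
      then show False using nontriv True by blast
    next
      case False
      then have e: "\<epsilon> = - 1" using eps by blast
      have "5 ^ a + 5 ^ x = 5 ^ b + (5 ^ y :: int)" "5 ^ a + 5 ^ x = 5 ^ c + (5 ^ z :: int)" using y z e by simp_all
      then have "x = b" "x = c" using power5_sum_eq abc(4,5) by blast+
      then show False using abc(6) by blast
    qed
  qed
qed

lemma mark_even: "even (mark j)" using k_odd by (simp add: mark_def)

lemma iota_comark: "iota (comark j) = mark j mod L"
  unfolding comark_def mark_def by (rule iota_special)

lemma iota_mark: "iota (mark j) = comark j mod L"
  using iota_iota[of "comark j"] by (simp add: iota_comark iota_mod)

text \<open>Marked indices of one parity share a residue modulo \<open>2 * k\<close>, while a face
  step keeps the parity and adds \<open>k + 1\<close>. Thus every face has an unmarked index among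
  its first two.\<close>

lemma marked_step:
  assumes "marked p" shows "\<not> marked (step p)"
proof
  have m: "[p = (if even p then k + 1 else 1)] (mod 2 * k)" if p: "marked p" for p
  proof -
    have cong: "[p = q] (mod 2 * k)" "even p \<longleftrightarrow> even q" if "[p = q] (mod L)" for q
      using cong_dvd_modulus[OF that, of "2 * k"] cong_dvd_modulus[OF that, of 2]
      by (simp_all add: cong_dvd_iff)
    have 1: "[mark j = k + 1] (mod 2 * k)" for j
    proof -
      have "mark j - (k + 1) = 2 * k * (2 * 5 ^ j - 1)" by (simp add: mark_def algebra_simps)
      then show ?thesis by (simp add: cong_iff_dvd_diff)
    qed
    have 2: "[comark j = 1] (mod 2 * k)" "odd (comark j)" for j
      by (simp_all add: comark_def cong_iff_dvd_diff)
    from p obtain j where "[p = mark j] (mod L) \<or> [p = comark j] (mod L)" unfolding marked_def by blast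
    then show ?thesis
    proof
      assume "[p = mark j] (mod L)"
      then show ?thesis using cong_trans[OF cong(1) 1] cong(2) mark_even by simp
    next
      assume "[p = comark j] (mod L)"
      then show ?thesis using cong_trans[OF cong(1) 2(1)] cong(2) 2(2) by simp
    qed
  qed
  assume "marked (step p)"
  have par: "even (step p) \<longleftrightarrow> even p" by (simp add: iota_parity)
  have "[step p = p] (mod 2 * k)" using m[OF \<open>marked (step p)\<close>] m[OF assms]
    unfolding par by (rule cong_trans[OF _ cong_sym])
  then have "[p + k + 1 = p] (mod 2 * k)"
    by (rule cong_trans[OF cong_sym[OF cong_add[OF iota_mod_2k cong_refl]]])
  then have "2 * k dvd k + 1" by (simp add: cong_iff_dvd_diff add.assoc)
  then show False using k_ge zdvd_imp_le[of "2 * k" "k + 1"] by simp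
qed

end

section \<open>Assigning differences to indices\<close>

text \<open>The bound on \<open>t\<close> gives \<open>40 < m\<close>, so the labels, all below 20,
  are admissible differences smaller than half of \<open>v\<close>.\<close>

locale half_system = large_tour +
  fixes t :: nat
  assumes t_pos: "0 < t" and t_dvd: "int t dvd L" and t_small: "40 * int t < L"
begin

definition "w = nat L + t"

abbreviation "v \<equiv> int w"
abbreviation "m \<equiv> int (w div t)"

definition "D = {d \<in> {0..<v}. \<not> m dvd d}"
definition "H = {d \<in> D. 2 * d < v}"
text \<open>Each pair of indices matched by \<open>iota\<close> has exactly one even member, which
  serves as the name of the cell.\<close>

definition "X = {p \<in> {0..<L}. even p}"
definition "cell p = (if even p then p mod L else iota p)"
definition "P = (\<lambda>j. mark j mod L) ` {..<17}"
text \<open>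
  The values to be prescribed satisfy \<open>label 0 + label l = label (l + 8)\<close> for \<open>1 \<le> l \<le> 8\<close>.
\<close>

definition "label j = (if j = 0 then 1 else if j \<le> 8 then 2 * int j + 1 else 2 * int j - 14)"

lemma L_pos: "0 < L" using n_pos k_ge by simp
lemma v_eq: "v = L + int t" using L_pos by (simp add: w_def)
lemma t_dvd_w: "t dvd w"
proof -
  have "int t dvd v" using t_dvd by (simp add: v_eq)
  then show ?thesis by simp
qed
lemma m_t: "m * int t = v" using t_dvd_w by (metis dvd_div_mult_self of_nat_mult)
lemma v_pos: "0 < v" using L_pos v_eq by simp

lemma m_large: "40 < m"
proof -
  have "40 * int t < m * int t" using t_small by (simp add: m_t v_eq)
  then show ?thesis using t_pos by simp
qed

lemma m_le_v: "m \<le> v"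
proof -
  have "m * 1 \<le> m * int t" using t_pos m_large by (intro mult_left_mono) auto
  then show ?thesis by (simp add: m_t)
qed

lemma card_multiples: "card {d \<in> {0..<v}. m dvd d} = t"
proof -
  have "{d \<in> {0..<v}. m dvd d} = (\<lambda>i. m * i) ` {0..<int t}"
  proof (intro set_eqI iffI)
    fix d assume "d \<in> {d \<in> {0..<v}. m dvd d}"
    then obtain i where d: "d = m * i" "0 \<le> m * i" "m * i < m * int t" by (auto simp: m_t)
    have "0 < m" using m_large by simp
    then have "0 \<le> i" "i < int t" using d(2,3) by (auto simp: zero_le_mult_iff)
    then show "d \<in> (\<lambda>i. m * i) ` {0..<int t}" unfolding d(1) by (intro imageI) simp
  next
    fix d assume "d \<in> (\<lambda>i. m * i) ` {0..<int t}"
    then obtain i where d: "d = m * i" "0 \<le> i" "i < int t" by (metis atLeastLessThan_iff imageE)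
    have "m * i < m * int t" using d(3) m_large by simp
    then show "d \<in> {d \<in> {0..<v}. m dvd d}" using d m_large by (simp add: m_t)
  qed
  moreover have "inj_on (\<lambda>i. m * i) {0..<int t}" using m_large by (auto intro!: inj_onI)
  ultimately show ?thesis by (simp add: card_image)
qed

lemma finite_D: "finite D"
  by (rule finite_subset[of _ "{0..<v}"]) (auto simp: D_def)

lemma card_D: "card D = nat L"
proof -
  let ?M = "{d \<in> {0..<v}. m dvd d}"
  have "D = {0..<v} - ?M" by (auto simp: D_def)
  moreover have "?M \<subseteq> {0..<v}" by auto
  ultimately have "card D = card {0..<v} - card ?M"
    using card_Diff_subset[of ?M "{0..<v}"] finite_subset[of ?M "{0..<v}"] by simp
  then have "card D = w - t" unfolding card_multiples by simp
  then show ?thesis by (simp add: w_def)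
qed

lemma D_reflect: "d \<in> D \<Longrightarrow> v - d \<in> D"
proof -
  assume "d \<in> D"
  then have d: "0 \<le> d" "d < v" "\<not> m dvd d" unfolding D_def by auto
  have "m dvd v" using m_t by (metis dvd_triv_left)
  then have "\<not> m dvd v - d" using d(3) by (metis dvd_diff diff_diff_eq2 add_diff_cancel_left')
  moreover have "d \<noteq> 0" using d(3) by auto
  ultimately show ?thesis using d unfolding D_def by simp
qed

text \<open>If \<open>v\<close> is even then so is \<open>t\<close>, and \<open>v div 2\<close> is a
  multiple of \<open>m\<close>. So no admissible difference is its own negative, and
  \<open>H\<close> picks one from each pair.\<close>

lemma D_not_half: "d \<in> D \<Longrightarrow> 2 * d \<noteq> v"
proof
  assume d: "d \<in> D" "2 * d = v"
  then have "even v" by (metis dvd_triv_left)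
  then have "even (int t)" by (simp add: v_eq)
  then obtain s where "int t = 2 * s" by auto
  then have "2 * d = 2 * (m * s)" using d(2) m_t by simp
  then show False using d(1) by (simp add: D_def)
qed

lemma H_or: "d \<in> D \<Longrightarrow> d \<in> H \<or> v - d \<in> H"
  using D_not_half[of d] D_reflect[of d] by (auto simp: H_def)

lemma H_bounds: "d \<in> H \<Longrightarrow> 0 < d \<and> 2 * d < v"
  by (cases "d = 0") (auto simp: H_def D_def)

lemma finite_H: "finite H" using finite_D by (simp add: H_def)

lemma card_H: "card H = nat (k * n)"
proof -
  have "bij_betw (\<lambda>d. v - d) H (D - H)"
  proof (rule bij_betwI[where g = "\<lambda>d. v - d"])
    show "(\<lambda>d. v - d) \<in> H \<rightarrow> D - H" using D_reflect by (auto simp: H_def)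
    show "(\<lambda>d. v - d) \<in> D - H \<rightarrow> H" using H_or by auto
  qed auto
  then have "card H = card (D - H)" by (rule bij_betw_same_card)
  moreover have "H \<subseteq> D" by (auto simp: H_def)
  then have "card (D - H) = card D - card H" "card H \<le> card D"
    using finite_D finite_H by (auto simp: card_Diff_subset card_mono)
  ultimately have "2 * card H = nat L" unfolding card_D by linarith
  also have "L = 2 * (k * n)" by (simp only: mult.assoc)
  finally show ?thesis by linarith
qed

lemma finite_X: "finite X"
  by (rule finite_subset[of _ "{0..<L}"]) (auto simp: X_def)

lemma card_X: "card X = nat (k * n)"
proof -
  have "X = (\<lambda>i. 2 * i) ` {0..<k * n}"
  proof (intro set_eqI iffI)
    fix x assume "x \<in> X"
    then have "x = 2 * (x div 2)" "x div 2 \<in> {0..<k * n}" by (auto simp: X_def)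
    then show "x \<in> (\<lambda>i. 2 * i) ` {0..<k * n}" by (rule image_eqI)
  qed (auto simp: X_def)
  then show ?thesis by (simp add: card_image inj_on_def)
qed

lemma cell_X: "cell p \<in> X"
proof (cases "even p")
  case True
  then show ?thesis using L_pos by (simp add: cell_def X_def dvd_mod_iff)
next
  case False
  then show ?thesis using iota_range[of p] iota_parity[of p] by (simp add: cell_def X_def)
qed

lemma cell_iota: "cell (iota p) = cell p"
  using iota_iota[of p] iota_parity[of p] iota_range[of p] unfolding cell_def by simp

lemma cell_mod: "cell (p mod L) = cell p"
  unfolding cell_def iota_mod by (simp add: dvd_mod_iff)

lemma cell_of_X: "x \<in> X \<Longrightarrow> cell x = x"
  by (simp add: cell_def X_def)

lemma cell_eq_iff: "cell p = cell q \<longleftrightarrow> p mod L = q mod L \<or> p mod L = iota q"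
proof
  assume c: "cell p = cell q"
  have e: "p mod L = cell p" "iota (cell p) = iota p" if "even p" for p
    using that by (simp_all add: cell_def iota_mod)
  have o: "iota p = cell p" "iota (cell p) = p mod L" if "odd p" for p
    using that by (simp_all add: cell_def iota_iota)
  show "p mod L = q mod L \<or> p mod L = iota q"
    using e(1)[of p] e[of q] o(2)[of p] o[of q] c by (cases "even p"; cases "even q") metis+
next
  assume "p mod L = q mod L \<or> p mod L = iota q"
  then show "cell p = cell q" using cell_mod cell_iota by metis
qed

section \<open>Marked cells and their prescribed values\<close>

lemma finite_P: "finite P" by (simp add: P_def)

lemma P_subset: "P \<subseteq> X"
  unfolding P_def
proof (rule image_subsetI)
  fix j show "mark j mod L \<in> X" using cell_X[of "mark j"] mark_even[of j] by (simp add: cell_def)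
qed

lemma mark_inj: "inj_on (\<lambda>j. mark j mod L) {..<17}"
  using mark_cong by (auto intro!: inj_onI simp: cong_def)

lemma card_P: "card P = 17" using mark_inj by (simp add: P_def card_image)

lemma cell_in_P: "cell p \<in> P \<longleftrightarrow> marked p"
proof -
  have "cell p = mark j mod L \<longleftrightarrow> [p = mark j] (mod L) \<or> [p = comark j] (mod L)" for j
  proof -
    have "mark j mod L = cell (mark j)" using mark_even by (simp add: cell_def)
    then show ?thesis using cell_eq_iff[of p "mark j"] by (simp add: iota_mark cong_def)
  qed
  then show ?thesis by (auto simp: P_def marked_def)
qed

lemma label_H: "j < 17 \<Longrightarrow> label j \<in> H"
proof -
  assume j: "j < 17"
  then have b: "0 < label j" "label j < 20" by (auto simp: label_def)
  then have "\<not> m dvd label j" using m_large zdvd_not_zless[of "label j" m] by auto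
  moreover have "40 < v" using m_large m_le_v by linarith
  ultimately show ?thesis using b unfolding H_def D_def by auto
qed

lemma label_inj: "inj_on label {..<17}"
  by (intro inj_onI) (auto simp: label_def split: if_splits, presburger+)

text \<open>A reference assignment; all others arise from it by permuting the unmarked cells and
  flipping signs.\<close>

lemma exists_base: "\<exists>f. bij_betw f X H \<and> (\<forall>j<17. f (mark j mod L) = label j)"
proof -
  define g where "g = label \<circ> inv_into {..<17} (\<lambda>j. mark j mod L)"
  have g: "g (mark j mod L) = label j" if "j < 17" for j
    using that inv_into_f_f[OF mark_inj] by (simp add: g_def)
  have im: "g ` P = label ` {..<17}" using g by (force simp: P_def)
  have "inj_on g P"
  proof (rule eq_card_imp_inj_on[OF finite_P])
    show "card (g ` P) = card P" by (simp add: im card_P card_image[OF label_inj])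
  qed
  then have b1: "bij_betw g P (g ` P)" by (rule inj_on_imp_bij_betw)
  have sub: "g ` P \<subseteq> H" using label_H by (auto simp: im)
  have "card (X - P) = card (H - g ` P)"
    using P_subset finite_P sub \<open>inj_on g P\<close>
    by (simp add: card_Diff_subset card_X card_H card_image)
  then obtain h where h: "bij_betw h (X - P) (H - g ` P)"
    using finite_same_card_bij finite_X finite_H by blast
  define f where "f x = (if x \<in> P then g x else h x)" for x
  have "bij_betw f (P \<union> (X - P)) (g ` P \<union> (H - g ` P))"
  proof (rule bij_betw_combine)
    show "bij_betw f P (g ` P)" using b1 by (subst bij_betw_cong[of P f g]) (auto simp: f_def)
    show "bij_betw f (X - P) (H - g ` P)" using h by (subst bij_betw_cong[of "X - P" f h]) (auto simp: f_def)
  qed auto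
  moreover have "P \<union> (X - P) = X" "g ` P \<union> (H - g ` P) = H" using P_subset sub by auto
  ultimately have "bij_betw f X H" by simp
  moreover have "\<forall>j<17. f (mark j mod L) = label j" using g by (auto simp: f_def P_def)
  ultimately show ?thesis by blast
qed

end

section \<open>Counting by transpositions\<close>

text \<open>Double counting of the pairs \<open>(p, q)\<close> with
  \<open>p \<circ> \<tau> q \<in> B\<close>: each element of \<open>B\<close> and each
  \<open>q\<close> give one such pair, and each \<open>p\<close> occurs in at most \<open>K\<close>
  of them.\<close>

lemma permutation_swap_count:
  assumes "finite X" and B: "B \<subseteq> {p. p permutes X}" and Q: "finite Q"
    and \<tau>: "\<And>q. q \<in> Q \<Longrightarrow> \<tau> q permutes X"
    and K: "\<And>p. p permutes X \<Longrightarrow> card {q \<in> Q. p \<circ> \<tau> q \<in> B} \<le> K"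
  shows "card B * card Q \<le> K * fact (card X)"
proof -
  let ?P = "{p. p permutes X}"
  have finP: "finite ?P" using assms(1) by (rule finite_permutations)
  let ?f = "\<lambda>(p, q). (p \<circ> inv (\<tau> q), q)"
  let ?S = "SIGMA p:?P. {q \<in> Q. p \<circ> \<tau> q \<in> B}"
  have cancel: "p \<circ> inv (\<tau> q) \<circ> \<tau> q = p" if "q \<in> Q" for p q
    using permutes_inv_o(2)[OF \<tau>[OF that]] by (simp add: comp_assoc)
  have "card (B \<times> Q) \<le> card ?S"
  proof (rule card_inj_on_le)
    show "inj_on ?f (B \<times> Q)" 
    proof (intro inj_onI)
      fix x y assume *: "x \<in> B \<times> Q" "y \<in> B \<times> Q" "?f x = ?f y"
      obtain p q where x: "x = (p, q)" by (cases x)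
      obtain p' where y: "y = (p', q)" using *(3) by (cases y) (simp add: x)
      have "p \<circ> inv (\<tau> q) \<circ> \<tau> q = p' \<circ> inv (\<tau> q) \<circ> \<tau> q" using *(3) by (simp add: x y)
      moreover have "q \<in> Q" using *(1) by (simp add: x)
      ultimately show "x = y" by (simp only: x y cancel)
    qed
    show "?f ` (B \<times> Q) \<subseteq> ?S"
    proof (intro image_subsetI)
      fix x assume "x \<in> B \<times> Q"
      then obtain p q where x: "x = (p, q)" and *: "p \<in> B" "q \<in> Q" by auto
      then have "p permutes X" using B by auto
      then have "p \<circ> inv (\<tau> q) permutes X" using \<tau> * by (meson permutes_compose permutes_inv)
      then show "?f x \<in> ?S" using * cancel[OF *(2), of p] by (simp only: x prod.case mem_Sigma_iff mem_Collect_eq simp_thms)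
    qed
    show "finite ?S" using finP Q by auto
  qed
  also have "\<dots> = (\<Sum>p\<in>?P. card {q \<in> Q. p \<circ> \<tau> q \<in> B})" using finP Q by simp
  also have "\<dots> \<le> (\<Sum>p\<in>?P. K)" using K by (intro sum_mono) auto
  also have "\<dots> = K * fact (card X)" using card_permutations[OF refl assms(1)] by simp
  finally show ?thesis by (simp add: card_cartesian_product)
qed

section \<open>Fillings and their rotations\<close>

locale filling = half_system +
  fixes f :: "int \<Rightarrow> int"
  assumes f_bij: "bij_betw f X H" and f_mark: "j < 17 \<Longrightarrow> f (mark j mod L) = label j"
begin

text \<open>\<open>S\<close> collects the cells with flipped sign; comparing with
  \<open>odd p\<close> gives the two indices of a cell opposite signs.\<close>

definition "sg S p = (if (cell p \<in> S) = odd p then 1 else - 1 :: int)"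
definition "val S p x = (sg S p * f x) mod v"
definition "fill \<pi> S p = val S p (\<pi> (cell p))"

lemma f_H: "x \<in> X \<Longrightarrow> f x \<in> H" using f_bij by (auto dest: bij_betwE)

lemma f_inj: "x \<in> X \<Longrightarrow> y \<in> X \<Longrightarrow> f x = f y \<longleftrightarrow> x = y"
  using f_bij by (meson bij_betw_def inj_on_eq_iff)

lemma val_eq:
  assumes "x \<in> X" "y \<in> X"
  shows "val S p x = val S q y \<longleftrightarrow> x = y \<and> sg S p = sg S q"
proof -
  have b: "0 < f x" "2 * f x < v" "0 < f y" "2 * f y < v" using H_bounds f_H assms by auto
  have z: "a = 0" if "v dvd a" "\<bar>a\<bar> < v" for a using dvd_imp_le_int[of a v] that v_pos by linarith
  have "val S p x = val S q y \<longleftrightarrow> v dvd sg S p * f x - sg S q * f y" by (simp add: val_def mod_eq_dvd_iff)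
  also have "\<dots> \<longleftrightarrow> f x = f y \<and> sg S p = sg S q"
  proof
    assume "v dvd sg S p * f x - sg S q * f y"
    then have "sg S p * f x - sg S q * f y = 0" by (rule z) (use b in \<open>auto simp: sg_def\<close>)
    then show "f x = f y \<and> sg S p = sg S q" using b by (auto simp: sg_def split: if_splits)
  qed auto
  finally show ?thesis using f_inj assms by simp
qed

lemma val_minus: "sg S q = - sg S p \<Longrightarrow> val S q x = (- val S p x) mod v"
  by (simp add: val_def mod_minus_eq)

lemma val_D: "x \<in> X \<Longrightarrow> val S p x \<in> D"
proof -
  assume x: "x \<in> X"
  have h: "f x \<in> H" using f_H x by blast
  then have "f x \<in> D" "v - f x \<in> D" using D_reflect by (auto simp: H_def)
  moreover have "(- f x) mod v = v - f x"
    using H_bounds[OF h] by (simp add: zmod_zminus1_eq_if)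
  ultimately show ?thesis using H_bounds[OF h] by (simp add: val_def sg_def)
qed

lemma sg_iota: "sg S (iota p) = - sg S p"
  by (auto simp: sg_def cell_iota iota_parity)

lemma sg_cell: "cell p = cell q \<Longrightarrow> sg S p = sg S q \<longleftrightarrow> even p = even q"
  by (auto simp: sg_def)

lemma fill_mod: "fill \<pi> S (p mod L) = fill \<pi> S p"
  by (simp add: fill_def val_def sg_def cell_mod dvd_mod_iff)

lemma cyclic_rotation_fill:
  assumes \<pi>: "\<pi> permutes X"
  shows "cyclic_rotation w t L (fill \<pi> S) iota"
proof
  have mem: "\<pi> (cell p) \<in> X" for p using \<pi> cell_X permutes_in_image by metis
  show "0 < t" by (rule t_pos)
  show "t dvd w" by (rule t_dvd_w)
  show "t < w" using L_pos by (simp add: w_def)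
  have "3 * 1 \<le> k * n" using k_ge n_pos by (intro mult_mono) auto
  then show "2 < L" by simp
  show "even L" by simp
  show "(fill \<pi> S p = fill \<pi> S q) = (p mod L = q mod L)" for p q
  proof
    assume "fill \<pi> S p = fill \<pi> S q"
    then have 1: "\<pi> (cell p) = \<pi> (cell q)" "sg S p = sg S q" using mem by (auto simp: fill_def val_eq)
    then have 2: "cell p = cell q" using permutes_inj[OF \<pi>] by (auto dest: injD)
    then have "even p = even q" using sg_cell 1 by blast
    then show "p mod L = q mod L" using 2 iota_iota by (metis cell_def)
  next
    assume "p mod L = q mod L" then show "fill \<pi> S p = fill \<pi> S q" by (metis fill_mod)
  qed
  have "range (fill \<pi> S) = D"
  proof (intro set_eqI iffI)
    fix d assume "d \<in> range (fill \<pi> S)" then show "d \<in> D" using val_D mem by (auto simp: fill_def)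
  next
    fix d assume d: "d \<in> D"
    \<comment> \<open>\<open>b\<close> is the sign that moves \<open>d\<close> into
      \<open>H\<close>; the index sought is the one of the right cell with this sign.\<close>
    obtain b where b: "b \<in> {1, - 1::int}" "(b * d) mod v \<in> H"
    proof (cases "d \<in> H")
      case True
      then show ?thesis using H_bounds[OF True] that[of 1] by simp
    next
      case False
      then have *: "v - d \<in> H" using H_or d by blast
      have "(- d) mod v = v - d" using * d H_bounds[OF *] by (auto simp: zmod_zminus1_eq_if D_def)
      then show ?thesis using * that[of "- 1"] by simp
    qed
    then obtain x where x: "x \<in> X" "f x = (b * d) mod v" using f_bij by (metis bij_betw_iff_bijections)
    obtain c where c: "c \<in> X" "\<pi> c = x" using x(1) permutes_image[OF \<pi>] by (metis imageE)
    obtain p where p: "cell p = c" "sg S p = b"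
    proof (cases "sg S c = b")
      case True then show ?thesis using that cell_of_X[OF c(1)] by blast
    next
      case False
      then have "sg S c = - b" using b(1) by (auto simp: sg_def split: if_splits)
      then have "sg S (iota c) = b" by (simp add: sg_iota)
      then show ?thesis using that cell_of_X[OF c(1)] cell_iota by metis
    qed
    have "fill \<pi> S p = (b * (b * d)) mod v" by (simp add: fill_def val_def p c(2) x(2) mod_mult_right_eq)
    also have "b * (b * d) = d" using b(1) by auto
    also have "d mod v = d" using d by (simp add: D_def)
    finally show "d \<in> range (fill \<pi> S)" by (metis rangeI)
  qed
  then show "range (fill \<pi> S) = {d \<in> {0..<v}. \<not> m dvd d}" by (simp add: D_def)
  show "iota (p mod L) = iota p" for p by (rule iota_mod)
  show "iota (iota p) = p mod L" for p by (rule iota_iota)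
  show "even (iota p) = odd p" for p by (rule iota_parity)
  show "fill \<pi> S (iota p) = (- fill \<pi> S p) mod v" for p
    unfolding fill_def cell_iota by (rule val_minus) (rule sg_iota)
qed

lemma periodic_rotation_fill:
  assumes \<pi>: "\<pi> permutes X"
  shows "periodic_rotation w t L (fill \<pi> S) iota (nat k)"
proof -
  interpret R: cyclic_rotation w t L "fill \<pi> S" iota by (rule cyclic_rotation_fill[OF \<pi>])
  have fs: "R.face_step = (\<lambda>p. step p)" by (simp add: R.face_step_def fun_eq_iff)
  then show ?thesis
  proof unfold_locales
    show "0 < nat k" using k_ge by simp
    show "(R.face_step ^^ j) p mod L = p mod L \<longleftrightarrow> nat k dvd j" for j p
    proof -
      have "nat k dvd j \<longleftrightarrow> k dvd int j" using k_ge by (simp add: nat_dvd_iff)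
      then show ?thesis using step_period[of j p] fs by simp
    qed
  qed
qed

lemma fill_mark:
  assumes \<pi>: "\<pi> permutes (X - P)" and S: "S \<subseteq> X - P" and j: "j < 17"
  shows "fill \<pi> S (mark j) = label j"
proof -
  have c: "cell (mark j) = mark j mod L" using mark_even by (simp add: cell_def)
  have P: "mark j mod L \<in> P" using j by (auto simp: P_def)
  then have "\<pi> (mark j mod L) = mark j mod L" using \<pi> by (metis DiffD2 permutes_not_in)
  moreover have "sg S (mark j) = 1" using S P mark_even by (auto simp: sg_def c)
  ultimately show ?thesis using f_mark[OF j] H_bounds[OF label_H[OF j]] by (simp add: fill_def val_def c)
qed

lemma fill_inj:
  assumes "\<pi> permutes X" "\<pi>' permutes X" "S \<subseteq> X" "S' \<subseteq> X" and eq: "fill \<pi> S = fill \<pi>' S'"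
  shows "\<pi> = \<pi>' \<and> S = S'"
proof -
  have *: "\<pi> x = \<pi>' x \<and> (x \<in> S \<longleftrightarrow> x \<in> S')" if x: "x \<in> X" for x
  proof -
    have m: "\<pi> x \<in> X" "\<pi>' x \<in> X" using assms(1,2) x permutes_in_image by metis+
    have e: "even x" using x by (simp add: X_def)
    define s s' where "s = sg S x" and "s' = sg S' x"
    have sg: "s \<in> {1, - 1}" "s' \<in> {1, - 1}" "s = s' \<longleftrightarrow> (x \<in> S \<longleftrightarrow> x \<in> S')"
      using e by (auto simp: s_def s'_def sg_def cell_of_X[OF x])
    have "(s * f (\<pi> x)) mod v = (s' * f (\<pi>' x)) mod v"
      using fun_cong[OF eq, of x] by (simp only: fill_def val_def cell_of_X[OF x] s_def s'_def)
    then have "v dvd s * f (\<pi> x) - s' * f (\<pi>' x)" by (simp add: mod_eq_dvd_iff)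
    moreover have b: "0 < f (\<pi> x)" "2 * f (\<pi> x) < v" "0 < f (\<pi>' x)" "2 * f (\<pi>' x) < v"
      using H_bounds f_H m by auto
    then have "\<bar>s * f (\<pi> x) - s' * f (\<pi>' x)\<bar> < v" using sg(1,2) by auto
    ultimately have "s * f (\<pi> x) - s' * f (\<pi>' x) = 0"
      using dvd_imp_le_int[of "s * f (\<pi> x) - s' * f (\<pi>' x)" v] v_pos by linarith
    then have "f (\<pi> x) = f (\<pi>' x)" "s = s'" using b sg(1,2) by auto
    then show ?thesis using f_inj m sg(3) by blast
  qed
  then have "\<pi> = \<pi>'" using assms(1,2) by (metis ext permutes_not_in)
  moreover have "S = S'" using * assms(3,4) by blast
  ultimately show ?thesis by blast
qed

section \<open>Free cells and counting of bad fillings\<close>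

abbreviation "Fr \<equiv> X - P"

lemma finite_Fr: "finite Fr" using finite_X by simp

lemma card_Fr: "card Fr = nat (k * n) - 17"
  using P_subset finite_P by (simp add: card_Diff_subset card_X card_P)

lemma Fr_permutes: "\<pi> permutes Fr \<Longrightarrow> \<pi> permutes X"
  by (rule permutes_subset) auto

lemma val_bounds: "x \<in> X \<Longrightarrow> 0 < val S p x \<and> val S p x < v"
proof -
  assume "x \<in> X"
  then have "val S p x \<in> D" by (rule val_D)
  moreover have "0 \<notin> D" by (simp add: D_def)
  ultimately show ?thesis unfolding D_def by (metis (no_types, lifting) atLeastLessThan_iff mem_Collect_eq order_less_le)
qed

lemma dvd_diff_val: "x \<in> X \<Longrightarrow> y \<in> X \<Longrightarrow> v dvd val S p x - val S p y \<Longrightarrow> x = y"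
  using val_bounds[of x S p] val_bounds[of y S p] val_eq[of x y S p p]
  by (metis mod_eq_dvd_iff mod_pos_pos_trivial order_less_imp_le)

lemma not_marked_Fr: "\<not> marked p \<Longrightarrow> cell p \<in> Fr"
  using cell_X cell_in_P by simp

definition "csum e p = (\<Sum>i<nat k. e ((step ^^ i) p) :: int)"

text \<open>Exchanging the value at a free cell \<open>g\<close> of the face with that at a cell
  \<open>h\<close> off the face alters exactly one summand, so the sum vanishes for at most one
  \<open>h\<close>.\<close>

lemma zero_sum_count:
  "card {\<pi>. \<pi> permutes Fr \<and> v dvd csum (fill \<pi> S) q} * (nat (k * n) - 17 - nat k) \<le> fact (card Fr)"
proof -
  obtain i0 where i0: "i0 < 2" "\<not> marked ((step ^^ i0) q)"
  proof (cases "marked q")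
    case True
    then show ?thesis using marked_step that[of 1] by simp
  next
    case False
    then show ?thesis using that[of 0] by simp
  qed
  let ?pos = "\<lambda>i. (step ^^ i) q"
  let ?I = "{..<nat k}"
  have i0k: "i0 < nat k" using i0 k_ge by simp
  define g where "g = cell (?pos i0)"
  have g: "g \<in> Fr" unfolding g_def using i0(2) by (rule not_marked_Fr)
  have other: "cell (?pos i) \<noteq> g" if i: "i < nat k" "i \<noteq> i0" for i
  proof
    assume "cell (?pos i) = g"
    then have "?pos i mod L = ?pos i0 mod L \<or> ?pos i mod L = iota (?pos i0)" by (simp add: g_def cell_eq_iff)
    moreover have "?pos i mod L \<noteq> ?pos i0 mod L"
    proof (cases "i < i0")
      case True
      then show ?thesis using step_funpow_distinct[of i i0 q] i0k by simp
    next
      case False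
      then have "i0 < i" "int i < k" using i by auto
      then show ?thesis using step_funpow_distinct[of i0 i q] by metis
    qed
    \<comment> \<open>The two indices of a cell have different parities, so a face never contains
      both; no cell is met twice.\<close>
    moreover have "?pos i mod L \<noteq> iota (?pos i0)"
    proof
      assume a: "?pos i mod L = iota (?pos i0)"
      have "even (?pos i mod L) \<longleftrightarrow> even q" using step_funpow_parity[of i q] by (simp add: dvd_mod_iff)
      moreover have "even (iota (?pos i0)) \<longleftrightarrow> odd q" using step_funpow_parity[of i0 q] by (simp add: iota_parity)
      ultimately show False using a by simp
    qed
    ultimately show False by blast
  qed
  define Z where "Z = (\<lambda>i. cell (?pos i)) ` ?I"
  have Z: "finite Z" "card Z \<le> nat k" unfolding Z_def using card_image_le[of ?I] by simp_all
  define B where "B = {\<pi>. \<pi> permutes Fr \<and> v dvd csum (fill \<pi> S) q}"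
  have "card B * card (Fr - Z) \<le> 1 * fact (card Fr)"
  proof (rule permutation_swap_count[where \<tau> = "\<lambda>h. transpose g h"])
    show "finite Fr" "finite (Fr - Z)" using finite_Fr by auto
    show "B \<subseteq> {p. p permutes Fr}" by (auto simp: B_def)
    show "transpose g h permutes Fr" if "h \<in> Fr - Z" for h
      using g that by (intro permutes_swap_id) auto
    fix \<pi> assume \<pi>: "\<pi> permutes Fr"
    have mem: "\<pi> x \<in> X" if "x \<in> X" for x using Fr_permutes[OF \<pi>] that permutes_in_image by metis
    define A where "A = (\<Sum>i\<in>?I - {i0}. fill \<pi> S (?pos i))"
    have sum: "csum (fill (\<pi> \<circ> transpose g h) S) q = val S (?pos i0) (\<pi> h) + A" if h: "h \<in> Fr - Z" for h
    proof -
      have "csum (fill (\<pi> \<circ> transpose g h) S) q = fill (\<pi> \<circ> transpose g h) S (?pos i0)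
          + (\<Sum>i\<in>?I - {i0}. fill (\<pi> \<circ> transpose g h) S (?pos i))"
        unfolding csum_def using i0k by (intro sum.remove) auto
      also have "fill (\<pi> \<circ> transpose g h) S (?pos i0) = val S (?pos i0) (\<pi> h)"
        by (simp add: fill_def g_def[symmetric])
      also have "(\<Sum>i\<in>?I - {i0}. fill (\<pi> \<circ> transpose g h) S (?pos i)) = A"
        unfolding A_def
      proof (rule sum.cong[OF refl])
        fix i assume i: "i \<in> ?I - {i0}"
        then have "cell (?pos i) \<in> Z" by (auto simp: Z_def)
        then have "cell (?pos i) \<noteq> h" using h by auto
        moreover have "cell (?pos i) \<noteq> g" using other i by auto
        ultimately show "fill (\<pi> \<circ> transpose g h) S (?pos i) = fill \<pi> S (?pos i)"
          by (simp add: fill_def transpose_apply_other)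
      qed
      finally show ?thesis .
    qed
    have "h = h'" if h: "h \<in> {h \<in> Fr - Z. \<pi> \<circ> transpose g h \<in> B}" "h' \<in> {h \<in> Fr - Z. \<pi> \<circ> transpose g h \<in> B}" for h h'
    proof -
      have "v dvd val S (?pos i0) (\<pi> h) + A" "v dvd val S (?pos i0) (\<pi> h') + A"
        using h sum by (auto simp: B_def)
      then have "v dvd (val S (?pos i0) (\<pi> h) + A) - (val S (?pos i0) (\<pi> h') + A)" by (rule dvd_diff)
      then have "v dvd val S (?pos i0) (\<pi> h) - val S (?pos i0) (\<pi> h')" by simp
      moreover have "\<pi> h \<in> X" "\<pi> h' \<in> X" using h mem by auto
      ultimately have "\<pi> h = \<pi> h'" using dvd_diff_val by blast
      then show ?thesis using permutes_inj[OF \<pi>] by (auto dest: injD)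
    qed
    moreover have "finite {h \<in> Fr - Z. \<pi> \<circ> transpose g h \<in> B}"
      by (rule finite_subset[OF _ finite_Fr]) auto
    ultimately show "card {h \<in> Fr - Z. \<pi> \<circ> transpose g h \<in> B} \<le> 1"
      unfolding One_nat_def by (simp only: card_le_Suc0_iff_eq) blast
  qed
  moreover have "nat (k * n) - 17 - nat k \<le> card (Fr - Z)"
    using diff_card_le_card_Diff[OF Z(1), of Fr] Z(2) card_Fr by linarith
  ultimately show ?thesis unfolding B_def by (metis (no_types, lifting) le_trans mult_le_mono2 mult_1)
qed

text \<open>The flag \<open>b\<close> records whether the second index lies in the cell of the
  unknown value. If not, the equation determines the value. If so, equal signs cancel and contradict
  \<open>c1\<close> being nonzero modulo \<open>v\<close>, while opposite signs leave a doubling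
  equation with at most two solutions.\<close>

lemma solution_count:
  assumes \<pi>: "\<pi> permutes X" and Y: "Y \<subseteq> X" and c1: "0 < c1" "c1 < v"
  shows "card {h \<in> Y. v dvd c1 + (if b then val S p (\<pi> h) else c2) - val S q (\<pi> h)} \<le> 2"
    (is "card ?S \<le> 2")
proof -
  have finY: "finite Y" using Y finite_X finite_subset by blast
  have mem: "\<pi> h \<in> X" if "h \<in> Y" for h using \<pi> Y that permutes_in_image by (metis subsetD)
  have inj: "h = h'" if "h \<in> Y" "h' \<in> Y" "val S q (\<pi> h) = val S q (\<pi> h')" for h h'
    using that mem val_eq permutes_inj[OF \<pi>] by (metis injD)
  show ?thesis
  proof (cases b)
    case False
    have "h = h'" if "h \<in> ?S" "h' \<in> ?S" for h h'
    proof -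
      have "v dvd c1 + c2 - val S q (\<pi> h')" "v dvd c1 + c2 - val S q (\<pi> h)"
        using that False by simp_all
      then have "v dvd (c1 + c2 - val S q (\<pi> h')) - (c1 + c2 - val S q (\<pi> h))" by (rule dvd_diff)
      then have "v dvd val S q (\<pi> h) - val S q (\<pi> h')" by simp
      then have "\<pi> h = \<pi> h'" using that mem dvd_diff_val by blast
      then show ?thesis using permutes_inj[OF \<pi>] by (auto dest: injD)
    qed
    then have "card ?S \<le> Suc 0" using finY by (subst card_le_Suc0_iff_eq) auto
    then show ?thesis by simp
  next
    case True
    show ?thesis
    proof (cases "sg S p = sg S q")
      case same: True
      have "h \<notin> ?S" for h
      proof
        assume "h \<in> ?S"
        then have "v dvd c1" using True same by (simp add: val_def)
        then show False using c1 zdvd_imp_le by fastforce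
      qed
      then have "?S = {}" by blast
      then show ?thesis by (simp only: card.empty)
    next
      case False
      then have neg: "sg S p = - sg S q" by (auto simp: sg_def split: if_splits)
      have "(\<lambda>h. val S q (\<pi> h)) ` ?S \<subseteq> {c1 div 2, (c1 + v) div 2}"
      proof (rule image_subsetI)
        fix h assume h: "h \<in> ?S"
        let ?y = "val S q (\<pi> h)"
        have y: "0 < ?y" "?y < v" using val_bounds mem h by auto
        have "val S p (\<pi> h) = (- ?y) mod v" by (rule val_minus[OF neg])
        then have "val S p (\<pi> h) = v - ?y" using y by (simp add: zmod_zminus1_eq_if)
        then have "v dvd c1 + (v - ?y) - ?y" using h True by simp
        then have "v dvd (c1 + (v - ?y) - ?y) - v" by (rule dvd_diff) simp
        then have "v dvd c1 - 2 * ?y" by (simp add: algebra_simps)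
        then obtain j where j: "c1 - 2 * ?y = v * j" by auto
        have "v * j < v * 1" "v * (- 2) < v * j" using j c1 y by linarith+
        then have "j < 1" "- 2 < j" using v_pos by (simp_all only: mult_less_cancel_left_pos)
        then have "j = 0 \<or> j = - 1" by auto
        then have "2 * ?y = c1 \<or> 2 * ?y = c1 + v" using j by auto
        then show "?y \<in> {c1 div 2, (c1 + v) div 2}" by auto
      qed
      then have "card ((\<lambda>h. val S q (\<pi> h)) ` ?S) \<le> card {c1 div 2, (c1 + v) div 2}" by (intro card_mono) auto
      also have "\<dots> \<le> 2" by (simp add: card_insert_if)
      also have "card ((\<lambda>h. val S q (\<pi> h)) ` ?S) = card ?S"
        using inj by (intro card_image inj_onI) auto
      finally show ?thesis .
    qed
  qed
qed

text \<open>
  An automorphism that fixes 0 and acts on the neighbours of 0 by \<open>p \<mapsto> \<epsilon> p + i\<close> acts on the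
  neighbours of any other vertex by some \<open>p \<mapsto> \<epsilon> p + i'\<close>, where \<open>i'\<close> is found by following the edge
  back to 0. Hence it turns \<open>e q + e a = e b\<close> into
  \<open>e (\<epsilon> q + i) + e (\<iota> (\<epsilon> q + i) + \<epsilon> (a - \<iota> q)) = e (\<epsilon> b + i)\<close>.
\<close>

definition "first_pos \<epsilon> i = \<epsilon> * mark 0 + i"
definition "second_pos \<epsilon> i l = iota (first_pos \<epsilon> i) + \<epsilon> * (mark (l - 8) - iota (mark 0))"
definition "sum_pos \<epsilon> i l = \<epsilon> * mark l + i"

definition "relations e \<epsilon> i \<longleftrightarrow> (\<forall>l\<in>{9..<17}.
  v dvd e (first_pos \<epsilon> i) + e (second_pos \<epsilon> i l) - e (sum_pos \<epsilon> i l))"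

lemma mark_multiple_cong:
  assumes "\<epsilon> \<in> {1, - 1}" "(\<epsilon> * mark a + i) mod L = (\<epsilon> * mark b + i) mod L" "a < 17" "b < 17"
  shows "a = b"
proof -
  have "L dvd \<epsilon> * (mark a - mark b)" using assms(2) by (simp add: mod_eq_dvd_iff right_diff_distrib)
  then have "L dvd mark a - mark b" using assms(1) by (auto simp: dvd_diff_commute)
  then show ?thesis using mark_cong assms(3,4) by (simp add: cong_iff_dvd_diff)
qed

text \<open>Of the eight relations at most two have a marked sum position and at most five are
  excluded by \<open>Y\<close>, so one remains.\<close>

lemma pick_free:
  assumes "\<epsilon> \<in> {1, - 1}" "\<not> (\<epsilon> = 1 \<and> L dvd i)" "finite Y" "card Y \<le> 5"
  shows "\<exists>l\<in>{9..<17}. \<not> marked (sum_pos \<epsilon> i l) \<and> sum_pos \<epsilon> i l mod L \<notin> Y"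
proof (rule ccontr)
  let ?M = "{l \<in> {9..<17}. marked (\<epsilon> * mark l + i)}" and ?N = "{l \<in> {9..<17}. sum_pos \<epsilon> i l mod L \<in> Y}"
  assume "\<not> ?thesis"
  then have "{9..<17} \<subseteq> ?M \<union> ?N" by (auto simp: sum_pos_def)
  then have "card {9..<17::nat} \<le> card (?M \<union> ?N)" by (intro card_mono) auto
  also have "\<dots> \<le> card ?M + card ?N" by (rule card_Un_le)
  also have "card ?M \<le> 2" by (rule marked_hits[OF assms(1,2)])
  also have "card ?N \<le> card Y"
  proof (rule card_inj_on_le[OF _ _ assms(3)])
    show "inj_on (\<lambda>l. sum_pos \<epsilon> i l mod L) ?N"
      using mark_multiple_cong[OF assms(1)] by (intro inj_onI) (auto simp: sum_pos_def)
  qed auto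
  finally show False using assms(4) by simp
qed

text \<open>Two relations \<open>a\<close> and \<open>b\<close> are chosen so that the sum cell of
  \<open>b\<close> is not its first cell and the sum cell of \<open>a\<close> does not occur in
  relation \<open>b\<close>. Exchanging the values at these free cells with \<open>h1\<close> and
  \<open>h2\<close> yields a triangular system: relation \<open>b\<close> leaves two choices of
  \<open>h2\<close>, and then relation \<open>a\<close> leaves two of \<open>h1\<close>.\<close>

lemma relations_count:
  assumes eps: "\<epsilon> \<in> {1, - 1}" and nontriv: "\<not> (\<epsilon> = 1 \<and> L dvd i)"
  shows "card {\<pi>. \<pi> permutes Fr \<and> relations (fill \<pi> S) \<epsilon> i} * ((nat (k * n) - 22) * (nat (k * n) - 23))
    \<le> 4 * fact (card Fr)"
proof -
  let ?p1 = "first_pos \<epsilon> i" and ?p2 = "second_pos \<epsilon> i" and ?p3 = "sum_pos \<epsilon> i"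
  obtain b where b: "b \<in> {9..<17}" "\<not> marked (?p3 b)" "?p3 b mod L \<notin> {iota ?p1}"
    using pick_free[OF eps nontriv, of "{iota ?p1}"] by auto
  \<comment> \<open>Both indices of every cell to be avoided; for the first cell
    \<open>iota ?p1\<close> is enough, since \<open>not0\<close> excludes the other index.\<close>
  let ?Y = "{iota ?p1, ?p2 b mod L, iota (?p2 b), ?p3 b mod L, iota (?p3 b)}"
  have "card ?Y \<le> 5" by (intro card_insert_le_m1) auto
  then obtain a where a: "a \<in> {9..<17}" "\<not> marked (?p3 a)" "?p3 a mod L \<notin> ?Y"
    using pick_free[OF eps nontriv, of ?Y] by auto
  define gA gB where "gA = cell (?p3 a)" and "gB = cell (?p3 b)"
  have not0: "?p3 l mod L \<noteq> ?p1 mod L" if "l \<in> {9..<17}" for l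
    using mark_multiple_cong[OF eps, of l i 0] that by (auto simp: sum_pos_def first_pos_def)
  have gA1: "cell ?p1 \<noteq> gA" and gB1: "cell ?p1 \<noteq> gB" and AB: "gA \<noteq> gB" and gA2: "cell (?p2 b) \<noteq> gA"
  proof -
    show "cell ?p1 \<noteq> gA" using a not0[OF a(1)] cell_eq_iff[of "?p3 a" ?p1] unfolding gA_def by auto
    show "cell ?p1 \<noteq> gB" using b not0[OF b(1)] cell_eq_iff[of "?p3 b" ?p1] unfolding gB_def by auto
    show "gA \<noteq> gB" using a cell_eq_iff[of "?p3 a" "?p3 b"] unfolding gA_def gB_def by auto
    show "cell (?p2 b) \<noteq> gA" using a cell_eq_iff[of "?p3 a" "?p2 b"] unfolding gA_def by auto
  qed
  have gFr: "gA \<in> Fr" "gB \<in> Fr" unfolding gA_def gB_def using a b not_marked_Fr by auto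
  define Z where "Z = {cell ?p1, cell (?p2 a), gA, cell (?p2 b), gB}"
  have Z: "finite Z" "card Z \<le> 5" unfolding Z_def by (simp, intro card_insert_le_m1) auto
  define Y where "Y = Fr - Z"
  define Q where "Q = (SIGMA h2:Y. Y - {h2})"
  define \<tau> where "\<tau> = (\<lambda>(h2, h1). transpose gA h1 \<circ> transpose gB h2)"
  have Y: "finite Y" "Y \<subseteq> X" "Y \<subseteq> Fr" using finite_Fr by (auto simp: Y_def)
  have cY: "nat (k * n) - 22 \<le> card Y"
    using diff_card_le_card_Diff[OF Z(1), of Fr] Z(2) card_Fr unfolding Y_def by linarith
  have cQ: "card Q = card Y * (card Y - 1)" using Y(1) by (simp add: Q_def)
  define B where "B = {\<pi>. \<pi> permutes Fr \<and> relations (fill \<pi> S) \<epsilon> i}"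
  have "card B * card Q \<le> 4 * fact (card Fr)"
  proof (rule permutation_swap_count)
    show "finite Fr" by (rule finite_Fr)
    show "finite Q" using Y(1) by (simp add: Q_def)
    show "B \<subseteq> {p. p permutes Fr}" by (auto simp: B_def)
    show "\<tau> h permutes Fr" if h: "h \<in> Q" for h
    proof -
      obtain h2 h1 where "h = (h2, h1)" "h1 \<in> Fr" "h2 \<in> Fr" using h Y(3) by (auto simp: Q_def)
      then show ?thesis unfolding \<tau>_def using gFr
        by (simp only: prod.case) (intro permutes_compose permutes_swap_id)
    qed
    fix \<pi> assume \<pi>: "\<pi> permutes Fr"
    have \<pi>X: "\<pi> permutes X" by (rule Fr_permutes[OF \<pi>])
    define c1 where "c1 = fill \<pi> S ?p1"
    have c1: "0 < c1" "c1 < v" using val_bounds \<pi>X cell_X permutes_in_image unfolding c1_def fill_def by metis+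
    define U where "U = {h2 \<in> Y. v dvd c1 + (if cell (?p2 b) = gB then val S (?p2 b) (\<pi> h2) else fill \<pi> S (?p2 b))
      - val S (?p3 b) (\<pi> h2)}"
    define V where "V h2 = {h1 \<in> Y. v dvd c1 + (if cell (?p2 a) = gA then val S (?p2 a) (\<pi> h1)
      else if cell (?p2 a) = gB then val S (?p2 a) (\<pi> h2) else fill \<pi> S (?p2 a)) - val S (?p3 a) (\<pi> h1)}" for h2
    have cU: "card U \<le> 2" unfolding U_def by (rule solution_count[OF \<pi>X Y(2) c1])
    have cV: "card (V h2) \<le> 2" for h2 unfolding V_def by (rule solution_count[OF \<pi>X Y(2) c1])
    have fin: "finite U" "finite (V h2)" for h2 using Y(1) by (auto simp: U_def V_def)
    have sub: "{q \<in> Q. \<pi> \<circ> \<tau> q \<in> B} \<subseteq> (SIGMA h2:U. V h2)"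
    proof
      fix q assume "q \<in> {q \<in> Q. \<pi> \<circ> \<tau> q \<in> B}"
      then obtain h2 h1 where q: "q = (h2, h1)" "h2 \<in> Y" "h1 \<in> Y" "h1 \<noteq> h2" and qB: "\<pi> \<circ> \<tau> q \<in> B"
        by (auto simp: Q_def)
      define \<pi>' where "\<pi>' = \<pi> \<circ> \<tau> q"
      have notZ: "h1 \<notin> Z" "h2 \<notin> Z" using q by (auto simp: Y_def)
      have hA: "h1 \<noteq> gA" "h2 \<noteq> gA" "h1 \<noteq> gB" "h2 \<noteq> gB" using notZ by (auto simp: Z_def)
      have at_B: "\<pi>' gB = \<pi> h2" using hA q(4) by (simp add: \<pi>'_def \<tau>_def q(1) transpose_apply_other)
      have at_A: "\<pi>' gA = \<pi> h1" using hA AB by (simp add: \<pi>'_def \<tau>_def q(1) transpose_apply_other)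
      have at: "\<pi>' c = \<pi> c" if "c \<in> Z" "c \<noteq> gA" "c \<noteq> gB" for c
      proof -
        have "c \<noteq> h1" "c \<noteq> h2" using that notZ by auto
        then show ?thesis using that by (simp add: \<pi>'_def \<tau>_def q(1) transpose_apply_other)
      qed
      have v1: "fill \<pi>' S ?p1 = c1" using at[of "cell ?p1"] gA1 gB1 by (simp add: fill_def c1_def Z_def)
      have v2b: "fill \<pi>' S (?p2 b) = (if cell (?p2 b) = gB then val S (?p2 b) (\<pi> h2) else fill \<pi> S (?p2 b))"
        using at[of "cell (?p2 b)"] gA2 at_B by (simp add: fill_def Z_def)
      have v2a: "fill \<pi>' S (?p2 a) = (if cell (?p2 a) = gA then val S (?p2 a) (\<pi> h1)
        else if cell (?p2 a) = gB then val S (?p2 a) (\<pi> h2) else fill \<pi> S (?p2 a))"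
        using at[of "cell (?p2 a)"] at_A at_B by (simp add: fill_def Z_def)
      have v3: "fill \<pi>' S (?p3 a) = val S (?p3 a) (\<pi> h1)" "fill \<pi>' S (?p3 b) = val S (?p3 b) (\<pi> h2)"
        using at_A at_B by (simp_all add: fill_def gA_def gB_def)
      have "relations (fill \<pi>' S) \<epsilon> i" using qB by (simp add: B_def \<pi>'_def)
      then have "v dvd fill \<pi>' S ?p1 + fill \<pi>' S (?p2 a) - fill \<pi>' S (?p3 a)"
        "v dvd fill \<pi>' S ?p1 + fill \<pi>' S (?p2 b) - fill \<pi>' S (?p3 b)"
        using a(1) b(1) unfolding relations_def by blast+
      then have "h2 \<in> U" "h1 \<in> V h2" unfolding v1 v2a v2b v3 U_def V_def using q by blast+
      then show "q \<in> (SIGMA h2:U. V h2)" by (simp add: q(1))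
    qed
    have "card {q \<in> Q. \<pi> \<circ> \<tau> q \<in> B} \<le> card (SIGMA h2:U. V h2)"
      using fin by (intro card_mono[OF _ sub]) auto
    also have "\<dots> = (\<Sum>h2\<in>U. card (V h2))" using fin by simp
    also have "\<dots> \<le> (\<Sum>h2\<in>U. 2)" by (intro sum_mono cV)
    also have "\<dots> \<le> 4" using cU by simp
    finally show "card {q \<in> Q. \<pi> \<circ> \<tau> q \<in> B} \<le> 4" .
  qed
  moreover have "(nat (k * n) - 22) * (nat (k * n) - 23) \<le> card Q"
    unfolding cQ using cY by (intro mult_mono) auto
  ultimately show ?thesis unfolding B_def by (meson le_trans mult_le_mono2)
qed

section \<open>Good fillings and the resulting rotations\<close>

definition "symmetries = ({1, - 1 :: int} \<times> {0..<L}) - {(1, 0)}"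

definition "good S = {\<pi>. \<pi> permutes Fr \<and> (\<forall>q\<in>reps. \<not> v dvd csum (fill \<pi> S) q) \<and>
  (\<forall>(\<epsilon>, i)\<in>symmetries. \<not> relations (fill \<pi> S) \<epsilon> i)}"

lemma finite_good: "finite (good S)"
  by (rule finite_subset[OF _ finite_permutations[OF finite_Fr]]) (auto simp: good_def)

text \<open>Union bound: the \<open>2 * n\<close> cycle sums spoil at most three quarters of the
  permutations, the at most \<open>4 * n * k\<close> nontrivial symmetries at most one
  eighth.\<close>

lemma card_good: "fact (card Fr) \<le> 8 * card (good S)"
proof -
  let ?F = "fact (card Fr) :: nat" and ?N = "nat (k * n)"
  define M1 M2 where "M1 = ?N - 17 - nat k" and "M2 = (?N - 22) * (?N - 23)"
  define B1 where "B1 q = {\<pi>. \<pi> permutes Fr \<and> v dvd csum (fill \<pi> S) q}" for q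
  define B2 where "B2 = (\<lambda>(\<epsilon>, i). {\<pi>. \<pi> permutes Fr \<and> relations (fill \<pi> S) \<epsilon> i})"
  define T1 T2 where "T1 = (\<Sum>q\<in>reps. card (B1 q))" and "T2 = (\<Sum>s\<in>symmetries. card (B2 s))"
  have finW: "finite {\<pi>. \<pi> permutes Fr}" by (rule finite_permutations[OF finite_Fr])
  have finS: "finite symmetries" by (simp add: symmetries_def)
  have "?F = card {\<pi>. \<pi> permutes Fr}" using card_permutations[OF refl finite_Fr] by simp
  also have "\<dots> \<le> card (good S \<union> ((\<Union>q\<in>reps. B1 q) \<union> (\<Union>s\<in>symmetries. B2 s)))"
  proof (rule card_mono)
    show "finite (good S \<union> ((\<Union>q\<in>reps. B1 q) \<union> (\<Union>s\<in>symmetries. B2 s)))"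
      by (rule finite_subset[OF _ finW]) (auto simp: good_def B1_def B2_def)
    show "{\<pi>. \<pi> permutes Fr} \<subseteq> good S \<union> ((\<Union>q\<in>reps. B1 q) \<union> (\<Union>s\<in>symmetries. B2 s))"
      by (auto simp: good_def B1_def B2_def)
  qed
  also have "\<dots> \<le> card (good S) + (card (\<Union>q\<in>reps. B1 q) + card (\<Union>s\<in>symmetries. B2 s))"
    using card_Un_le order_trans add_le_mono by (meson le_refl)
  also have "\<dots> \<le> card (good S) + (T1 + T2)"
    unfolding T1_def T2_def using card_UN_le[OF card_reps(1)] card_UN_le[OF finS] by (intro add_mono order.refl) auto
  finally have total: "?F \<le> card (good S) + (T1 + T2)" .
  have N3: "3 * n \<le> k * n" using k_ge n_pos by (intro mult_right_mono) auto
  have kn: "3 * (n - 1) \<le> k * (n - 1)" using k_ge n_pos by (intro mult_right_mono) auto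
  have big: "1000000 < n" using n_large by simp
  \<comment> \<open>The case \<open>k = 3\<close> is the tightest: \<open>2 * n\<close> out of about
    \<open>3 * n\<close>, below three quarters for large \<open>n\<close>.\<close>
  have M1: "8 * nat n \<le> 3 * M1 \<and> 0 < M1"
  proof -
    have "k * (n - 1) = k * n - k" by (simp add: algebra_simps)
    then have e: "3 * (n - 1) \<le> k * n - k" using kn by simp
    define x where "x = k * n - k"
    have x: "k * n - 17 - k = x - 17" by (simp add: x_def)
    have a: "8 * n \<le> 3 * (k * n - 17 - k)" unfolding x using e[folded x_def] big by presburger
    have a': "0 < k * n - 17 - k" unfolding x using e[folded x_def] big by presburger
    have "int M1 = k * n - 17 - k" using a' k_ge unfolding M1_def by linarith
    then have "8 * int (nat n) \<le> 3 * int M1 \<and> 0 < int M1" using a a' n_pos by simp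
    then show ?thesis by linarith
  qed
  have M2: "128 * ?N \<le> M2 \<and> 0 < M2"
  proof -
    have "1000 < k * n" using N3 big by linarith
    then have N: "1000 < ?N" by simp
    then have "(?N - 22) * 256 \<le> M2" unfolding M2_def by (intro mult_le_mono) auto
    then show ?thesis using N by linarith
  qed
  have "T1 * M1 = (\<Sum>q\<in>reps. card (B1 q) * M1)" by (simp add: T1_def sum_distrib_right)
  also have "\<dots> \<le> (\<Sum>q\<in>reps. ?F)"
    unfolding B1_def M1_def by (intro sum_mono zero_sum_count)
  also have "\<dots> \<le> 2 * nat n * ?F" using card_reps(2) by simp
  finally have "T1 * M1 \<le> 2 * nat n * ?F" .
  then have "4 * T1 * M1 \<le> (8 * nat n) * ?F" by (simp add: ac_simps)
  also have "\<dots> \<le> (3 * M1) * ?F" using M1 by (intro mult_right_mono) auto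
  finally have "(4 * T1) * M1 \<le> (3 * ?F) * M1" by (simp add: ac_simps)
  then have t1: "4 * T1 \<le> 3 * ?F" using M1 by (simp only: mult_le_cancel2)
  have "T2 * M2 = (\<Sum>s\<in>symmetries. card (B2 s) * M2)" by (simp add: T2_def sum_distrib_right)
  also have "\<dots> \<le> (\<Sum>s\<in>symmetries. 4 * ?F)"
  proof (rule sum_mono)
    fix s assume s0: "s \<in> symmetries"
    obtain \<epsilon> i where s1: "s = (\<epsilon>, i)" by (cases s)
    have s: "s = (\<epsilon>, i)" "\<epsilon> \<in> {1, - 1}" "i \<in> {0..<L}" "\<not> (\<epsilon> = 1 \<and> i = 0)"
      using s0 unfolding s1 symmetries_def by blast+
    have "\<not> L dvd i" if "i \<noteq> 0" using s(3) that zdvd_imp_le[of L i] by auto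
    then have "\<not> (\<epsilon> = 1 \<and> L dvd i)" using s(4) by blast
    then show "card (B2 s) * M2 \<le> 4 * ?F"
      using relations_count[OF s(2), of i S] by (simp add: B2_def s(1) M2_def)
  qed
  also have "\<dots> \<le> 4 * ?N * (4 * ?F)"
  proof -
    have "card symmetries \<le> card ({1, - 1 :: int} \<times> {0..<L})" unfolding symmetries_def by (intro card_mono) auto
    also have "\<dots> = 4 * ?N" using L_pos by (simp add: card_cartesian_product mult.assoc)
    finally show ?thesis unfolding sum_constant by (intro mult_mono) auto
  qed
  finally have "T2 * M2 \<le> 4 * ?N * (4 * ?F)" .
  then have "8 * T2 * M2 \<le> 128 * ?N * ?F" by (simp add: ac_simps)
  also have "\<dots> \<le> M2 * ?F" using M2 by (intro mult_right_mono) auto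
  finally have "(8 * T2) * M2 \<le> ?F * M2" by (simp add: ac_simps)
  then have t2: "8 * T2 \<le> ?F" using M2 by (simp only: mult_le_cancel2)
  show ?thesis using total t1 t2 by linarith
qed

definition "rotation \<pi> S = cyclic_rotation.rot w t (fill \<pi> S)"

lemma relations_mod: "relations (fill \<pi> S) \<epsilon> (i mod L) \<longleftrightarrow> relations (fill \<pi> S) \<epsilon> i"
proof -
  have c: "fill \<pi> S p = fill \<pi> S q" if "p mod L = q mod L" for p q using that by (metis fill_mod)
  have 1: "first_pos \<epsilon> (i mod L) mod L = first_pos \<epsilon> i mod L" by (simp add: first_pos_def mod_add_right_eq)
  have 2: "second_pos \<epsilon> (i mod L) = second_pos \<epsilon> i"
    using 1 unfolding second_pos_def by (metis iota_mod)
  have 3: "sum_pos \<epsilon> (i mod L) l mod L = sum_pos \<epsilon> i l mod L" for l by (simp add: sum_pos_def mod_add_right_eq)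
  show ?thesis unfolding relations_def 2 c[OF 1] c[OF 3] ..
qed

lemma rotation_properties:
  assumes S: "S \<subseteq> Fr" and good: "\<pi> \<in> good S"
  shows "biembedding (multipartite w t) (rotation \<pi> S)"
    and "embedding_aut (multipartite w t) (rotation \<pi> S) = cyclic_translations w"
    and "F \<in> faces (multipartite w t) (rotation \<pi> S) \<Longrightarrow> nat k dvd card F \<and> nat k < card F"
    and "prime w \<Longrightarrow> gonal (nat k * w) (multipartite w t) (rotation \<pi> S)"
proof -
  have \<pi>: "\<pi> permutes Fr" using good by (simp add: good_def)
  have \<pi>X: "\<pi> permutes X" by (rule Fr_permutes[OF \<pi>])
  interpret R: periodic_rotation w t L "fill \<pi> S" iota "nat k"
    by (rule periodic_rotation_fill[OF \<pi>X])
  show "biembedding (multipartite w t) (rotation \<pi> S)"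
    unfolding rotation_def by (rule R.biembedding_rot)
  show "embedding_aut (multipartite w t) (rotation \<pi> S) = cyclic_translations w"
    unfolding rotation_def
  proof (rule R.embedding_aut_rot)
    fix \<epsilon> i :: int
    assume eps: "\<epsilon> \<in> {1, - 1}"
      and hyp: "\<And>q a b. v dvd fill \<pi> S q + fill \<pi> S a - fill \<pi> S b \<Longrightarrow>
        v dvd fill \<pi> S (\<epsilon> * q + i) + fill \<pi> S (iota (\<epsilon> * q + i) + \<epsilon> * (a - iota q)) - fill \<pi> S (\<epsilon> * b + i)"
    have "relations (fill \<pi> S) \<epsilon> i" unfolding relations_def
    proof
      fix l :: nat assume l: "l \<in> {9..<17}"
      then have l': "l - 8 < 17" "l < 17" by auto
      have "label 0 + label (l - 8) = label l" using l by (auto simp: label_def)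
      then have "v dvd fill \<pi> S (mark 0) + fill \<pi> S (mark (l - 8)) - fill \<pi> S (mark l)"
        using fill_mark[OF \<pi> S, of 0] fill_mark[OF \<pi> S, of "l - 8"] fill_mark[OF \<pi> S, of l] l' by simp
      from hyp[OF this]
      show "v dvd fill \<pi> S (first_pos \<epsilon> i) + fill \<pi> S (second_pos \<epsilon> i l) - fill \<pi> S (sum_pos \<epsilon> i l)"
        by (simp only: first_pos_def second_pos_def sum_pos_def)
    qed
    then have "relations (fill \<pi> S) \<epsilon> (i mod L)" by (simp only: relations_mod)
    then have "(\<epsilon>, i mod L) \<notin> symmetries" using good unfolding good_def by blast
    then show "\<epsilon> = 1 \<and> L dvd i" using eps L_pos by (auto simp: symmetries_def dvd_eq_mod_eq_0)
  qed
  have fs: "R.face_step = (\<lambda>p. step p)" by (simp add: R.face_step_def fun_eq_iff)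
  \<comment> \<open>The cycle sum is constant along a face, and every face cycle meets
    \<open>reps\<close>, where goodness applies.\<close>
  have nz: "\<not> v dvd R.cycle_sum (nat k) p" for p
  proof -
    have cong: "R.cycle_sum (nat k) (p mod L) = R.cycle_sum (nat k) p" for p
      unfolding R.cycle_sum_def by (intro sum.cong refl) (simp only: R.e_eq R.face_step_funpow_cong[OF mod_mod_trivial])
    have steps: "R.cycle_sum (nat k) ((R.face_step ^^ j) p) = R.cycle_sum (nat k) p" for j
      by (induction j) (simp_all add: R.cycle_sum_step)
    obtain j where j: "(step ^^ j) p mod L \<in> reps" using reach_rep by blast
    have "R.cycle_sum (nat k) ((step ^^ j) p mod L) = R.cycle_sum (nat k) p"
      using cong steps[of j] by (simp only: fs)
    moreover have "R.cycle_sum (nat k) q = csum (fill \<pi> S) q" for q by (simp only: R.cycle_sum_def csum_def fs)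
    ultimately show ?thesis using good j unfolding good_def by auto
  qed
  show "nat k dvd card F \<and> nat k < card F" if "F \<in> faces (multipartite w t) (rotation \<pi> S)"
    using R.faces_card(1,2)[OF that[unfolded rotation_def] nz] by blast
  show "gonal (nat k * w) (multipartite w t) (rotation \<pi> S)" if "prime w"
    unfolding gonal_def rotation_def using R.faces_card(3)[OF _ nz that] by blast
qed

text \<open>At vertex 0 the rotation sends each value of the filling to the next one. As the value
  \<open>label 0\<close> sits at the known index \<open>mark 0\<close>, the whole sequence can be
  read off.\<close>

lemma rotation_inj:
  assumes "S \<subseteq> Fr" "S' \<subseteq> Fr" "\<pi> \<in> good S" "\<pi>' \<in> good S'" and eq: "rotation \<pi> S = rotation \<pi>' S'"
  shows "\<pi> = \<pi>' \<and> S = S'"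
proof -
  have \<pi>: "\<pi> permutes Fr" "\<pi>' permutes Fr" using assms by (simp_all add: good_def)
  note \<pi>X = \<pi>[THEN Fr_permutes]
  interpret R: cyclic_rotation w t L "fill \<pi> S" iota by (rule cyclic_rotation_fill[OF \<pi>X(1)])
  interpret R': cyclic_rotation w t L "fill \<pi>' S'" iota by (rule cyclic_rotation_fill[OF \<pi>X(2)])
  have zero: "0 \<in> {0..<v}" using v_pos by simp
  have next_: "fill \<pi> S (p + 1) = fill \<pi>' S' (p + 1)" if p: "fill \<pi> S p = fill \<pi>' S' p" for p
  proof -
    have d: "R.dart 0 q = (0, fill \<pi> S q)" "R'.dart 0 q = (0, fill \<pi>' S' q)" for q
      using R.e_bounds[of q] R'.e_bounds[of q] by (simp_all add: R.dart_def R'.dart_def R.nbr_def R'.nbr_def)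
    have "R.rot (R.dart 0 p) = R'.rot (R'.dart 0 p)" using eq p by (simp add: rotation_def d)
    then show ?thesis using R.rot_dart[OF zero, of p] R'.rot_dart[OF zero, of p] by (simp add: d)
  qed
  have "fill \<pi> S (mark 0 + int j) = fill \<pi>' S' (mark 0 + int j)" for j
  proof (induction j)
    case 0
    show ?case using fill_mark[OF \<pi>(1) assms(1), of 0] fill_mark[OF \<pi>(2) assms(2), of 0] by simp
  next
    case (Suc j)
    then show ?case using next_[of "mark 0 + int j"] by (simp add: ac_simps)
  qed
  from this[of "nat ((p - mark 0) mod L)" for p]
  have "fill \<pi> S (mark 0 + (p - mark 0) mod L) = fill \<pi>' S' (mark 0 + (p - mark 0) mod L)" for p
    using L_pos by simp
  moreover have "(mark 0 + (p - mark 0) mod L) mod L = p mod L" for p by (simp add: mod_add_right_eq)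
  ultimately have "fill \<pi> S = fill \<pi>' S'" by (metis ext fill_mod)
  then show ?thesis using fill_inj[OF \<pi>X] assms(1,2) by blast
qed

text \<open>For each of the \<open>2 ^ card Fr\<close> sign patterns, at least one eighth of the
  permutations of the free cells is good.\<close>

lemma rotation_family:
  "\<exists>\<F>. finite \<F> \<and> 2 ^ card Fr * fact (card Fr) \<le> 8 * card \<F> \<and>
    (\<forall>\<rho>\<in>\<F>. biembedding (multipartite w t) \<rho> \<and>
      embedding_aut (multipartite w t) \<rho> = cyclic_translations w \<and>
      (\<forall>F\<in>faces (multipartite w t) \<rho>. nat k dvd card F \<and> nat k < card F) \<and>
      (prime w \<longrightarrow> gonal (nat k * w) (multipartite w t) \<rho>))"
proof (intro exI conjI ballI impI)
  let ?I = "SIGMA S:Pow Fr. good S" and ?\<F> = "(\<lambda>(S, \<pi>). rotation \<pi> S) ` (SIGMA S:Pow Fr. good S)"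
  have fin: "finite ?I" using finite_Fr finite_good by auto
  then show "finite ?\<F>" by simp
  have "inj_on (\<lambda>(S, \<pi>). rotation \<pi> S) ?I"
  proof (rule inj_onI)
    fix x y assume *: "x \<in> ?I" "y \<in> ?I" "(\<lambda>(S, \<pi>). rotation \<pi> S) x = (\<lambda>(S, \<pi>). rotation \<pi> S) y"
    obtain S \<pi> S' \<pi>' where xy: "x = (S, \<pi>)" "y = (S', \<pi>')" by (cases x, cases y)
    show "x = y" using * rotation_inj[of S S' \<pi> \<pi>'] unfolding xy by simp
  qed
  then have "card ?\<F> = card ?I" by (rule card_image)
  also have "\<dots> = (\<Sum>S\<in>Pow Fr. card (good S))" using finite_Fr finite_good by simp
  finally have c: "8 * card ?\<F> = (\<Sum>S\<in>Pow Fr. 8 * card (good S))" by (simp add: sum_distrib_left)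
  have "2 ^ card Fr * fact (card Fr) = (\<Sum>S\<in>Pow Fr. fact (card Fr))" using finite_Fr by (simp add: card_Pow)
  also have "\<dots> \<le> 8 * card ?\<F>" unfolding c by (intro sum_mono card_good)
  finally show "2 ^ card Fr * fact (card Fr) \<le> 8 * card ?\<F>" .
  fix \<rho> assume "\<rho> \<in> ?\<F>"
  then obtain S \<pi> where "\<rho> = rotation \<pi> S" "S \<subseteq> Fr" "\<pi> \<in> good S" by auto
  note * = rotation_properties[OF this(2,3), folded this(1)]
  show "biembedding (multipartite w t) \<rho>" "embedding_aut (multipartite w t) \<rho> = cyclic_translations w"
    by (rule *)+
  show "gonal (nat k * w) (multipartite w t) \<rho>" if "prime w" by (rule *(4)[OF that])
  show "nat k dvd card F" "nat k < card F" if "F \<in> faces (multipartite w t) \<rho>" for F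
    using *(3)[OF that] by auto
qed

end

section \<open>The family of embeddings\<close>

lemma exists_rotation_family:
  fixes n k t :: nat
  assumes "0 < t" "odd n" "odd k" "3 \<le> k" "5 ^ 18 < n" "t dvd 2 * n * k" "40 * t < 2 * n * k"
  defines "v \<equiv> 2 * n * k + t"
  shows "\<exists>\<F>. finite \<F> \<and> 2 ^ (n * k - 17) * fact (n * k - 17) \<le> 8 * card \<F> \<and>
    (\<forall>\<rho>\<in>\<F>. biembedding (multipartite v t) \<rho> \<and>
      embedding_aut (multipartite v t) \<rho> = cyclic_translations v \<and>
      (\<forall>F\<in>faces (multipartite v t) \<rho>. k dvd card F \<and> k < card F) \<and>
      (prime v \<longrightarrow> gonal (k * v) (multipartite v t) \<rho>))"
proof -
  have L: "2 * int k * int n = int (2 * n * k)" by simp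
  interpret half_system "int n" "int k" t
  proof
    show "0 < int n" using assms(5) by simp
    show "5 ^ 18 < int n"
    proof -
      have "int (5 ^ 18) < int n" using assms(5) by (simp only: of_nat_less_iff)
      then show ?thesis by simp
    qed
    show "int t dvd 2 * int k * int n" unfolding L using assms(6) by (simp only: of_nat_dvd_iff)
    show "40 * int t < 2 * int k * int n" unfolding L using assms(7) by linarith
  qed (use assms in auto)
  obtain f where f: "bij_betw f X H" "\<forall>j<17. f (mark j mod (2 * int k * int n)) = label j"
    using exists_base by blast
  interpret filling "int n" "int k" t f
    by unfold_locales (use f in auto)
  have w: "w = v" by (simp only: w_def v_def L nat_int)
  have c: "card Fr = n * k - 17"
    unfolding card_Fr by (simp flip: of_nat_mult add: mult.commute)
  show ?thesis using rotation_family unfolding w c nat_int .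
qed

text \<open>The sign factor outweighs the loss from 17 prescribed values and the factor 8:
  \<open>N choose 18\<close> is at least \<open>(N / 18) ^ 18\<close>, and
  \<open>8 * 2 ^ 17 = 2 ^ 20\<close>.\<close>

lemma power_le_two_power:
  fixes N :: nat
  assumes N: "2 ^ 20 * 18 ^ 18 \<le> N"
  shows "8 * N ^ 17 * 2 ^ 17 \<le> 2 ^ N"
proof -
  have "18 \<le> N" using N by simp
  have "2 ^ 20 \<le> real N / 18 ^ 18"
  proof -
    have "real (2 ^ 20 * 18 ^ 18) \<le> real N" using N by (simp only: of_nat_le_iff)
    then show ?thesis by (simp add: pos_le_divide_eq)
  qed
  then have "real N ^ 17 * 2 ^ 20 \<le> real N ^ 17 * (real N / 18 ^ 18)" by (rule mult_left_mono) simp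
  also have "\<dots> = (real N / real 18) ^ 18" by (simp add: power_divide power_Suc2[of _ 17, simplified])
  also have "\<dots> \<le> real (N choose 18)" using \<open>18 \<le> N\<close> by (rule binomial_ge_n_over_k_pow_k)
  also have "\<dots> \<le> real (2 ^ N)" unfolding of_nat_le_iff by (rule binomial_le_pow2)
  finally have "real (8 * N ^ 17 * 2 ^ 17) \<le> real (2 ^ N)" by simp
  then show ?thesis by (simp only: of_nat_le_iff)
qed

lemma fact_le_power_mult_fact: "r \<le> n \<Longrightarrow> fact n \<le> n ^ r * (fact (n - r) :: nat)"
proof -
  assume r: "r \<le> n"
  have "fact n = fact n div fact (n - r) * (fact (n - r) :: nat)"
    by (simp add: fact_dvd)
  also have "\<dots> \<le> n ^ r * fact (n - r)"
    using fact_div_fact_le_pow[OF r] by (rule mult_right_mono) simp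
  finally show ?thesis .
qed

lemma nonzero_sum_proportion:
  fixes n k :: nat
  assumes "3 \<le> k" "k < n"
  shows "2 * real n < real n * real k - (real k - 1)"
    and "2 * real n / (real n * real k - (real k - 1)) \<le> 4 / real k"
proof -
  \<comment> \<open>In these nonnegative variables the difference becomes a polynomial with
    nonnegative coefficients.\<close>
  define x y where "x = real k - 3" and "y = real n - real k - 1"
  have xy: "0 \<le> x" "0 \<le> y" "real k = x + 3" "real n = x + y + 4" using assms by (auto simp: x_def y_def)
  have "real n * real k - (real k - 1) - 2 * real n = x * x + x * y + 4 * x + y + 2"
    unfolding xy(3,4) by (simp add: algebra_simps)
  moreover have "0 \<le> x * x" "0 \<le> x * y" using xy by auto
  ultimately show 1: "2 * real n < real n * real k - (real k - 1)" using xy by linarith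
  have "2 * real n * real k \<le> 4 * (real n * real k - (real k - 1))"
  proof -
    have "2 * real k \<le> real n * real k" using assms by (intro mult_right_mono) auto
    then show ?thesis by (simp add: algebra_simps)
  qed
  then show "2 * real n / (real n * real k - (real k - 1)) \<le> 4 / real k"
    using 1 assms by (simp add: field_simps)
qed

text \<open>For large \<open>n * k\<close> the family has at least \<open>fact (n * k)\<close>
  members, which suffices since both factors in the bound are at most 1. For small
  \<open>n * k\<close> the constant makes the bound nonpositive.\<close>

theorem corollary4p11:
  fixes t :: nat
  assumes "t > 0" and "\<not> [t = 0] (mod 4)"
  shows
    "(\<exists>D::real. \<forall>n k::nat. 3 \<le> k \<and> k < n \<longrightarrow>
        0 < 1 - 2 * real n / (real n * real k - (real k - 1)) \<and>
        \<bar>2 * real n / (real n * real k - (real k - 1))\<bar> \<le> D / real k) \<and>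
     (\<exists>C::real. \<forall>n k v::nat.
        0 < n \<and> 0 < k \<and> k < n \<and> t dvd 2 * n * k \<and>
        ((odd (n * k) \<and> n \<ge> k \<and> k \<ge> 3 \<and> gcd n (k - 1) = 1) \<or>
         (odd (n * k) \<and> n \<ge> k \<and> 3 < k \<and> k < 200) \<or>
         (odd (n * k) \<and> n \<ge> k \<and> k \<ge> 3 \<and> n \<ge> (k - 2) * (k - 1))) \<and>
        v = 2 * n * k + t \<longrightarrow>
        (\<exists>\<F> :: (int \<times> int \<Rightarrow> int \<times> int) set.
           finite \<F> \<and>
           (\<forall>\<rho> \<in> \<F>.
              biembedding (multipartite v t) \<rho> \<and>
              embedding_aut (multipartite v t) \<rho> = cyclic_translations v \<and>
              (\<forall>F \<in> faces (multipartite v t) \<rho>. k dvd card F \<and> k < card F)) \<and>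
           real (card \<F>) \<ge>
             (1 - 2 * real n / (real n * real k - (real k - 1))) *
             (1 - C / (real n * real k)) * fact (n * k) \<and>
           (prime v \<longrightarrow> t = 1 \<and> (\<forall>\<rho> \<in> \<F>. gonal (k * v) (multipartite v t) \<rho>))))"
proof (intro conjI)
  show "\<exists>D::real. \<forall>n k::nat. 3 \<le> k \<and> k < n \<longrightarrow>
        0 < 1 - 2 * real n / (real n * real k - (real k - 1)) \<and>
        \<bar>2 * real n / (real n * real k - (real k - 1))\<bar> \<le> D / real k"
  proof (intro exI[of _ 4] allI impI)
    fix n k :: nat
    assume "3 \<le> k \<and> k < n"
    then have p: "2 * real n < real n * real k - (real k - 1)"
      "2 * real n / (real n * real k - (real k - 1)) \<le> 4 / real k"
      using nonzero_sum_proportion by auto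
    moreover have "0 \<le> 2 * real n" by simp
    ultimately show "0 < 1 - 2 * real n / (real n * real k - (real k - 1)) \<and>
        \<bar>2 * real n / (real n * real k - (real k - 1))\<bar> \<le> 4 / real k"
      by (simp add: abs_if divide_less_0_iff)
  qed
next
  \<comment> \<open>The summands provide, in order, the growth of \<open>2 ^ N\<close>, the bound
    \<open>5 ^ 18 < n\<close>, the bound on \<open>t\<close>, and room for the 17 marked
    cells.\<close>
  define C :: nat where "C = 2 ^ 20 * 18 ^ 18 + 5 ^ 36 + 40 * t + 17"
  show "\<exists>C::real. \<forall>n k v::nat.
        0 < n \<and> 0 < k \<and> k < n \<and> t dvd 2 * n * k \<and>
        ((odd (n * k) \<and> n \<ge> k \<and> k \<ge> 3 \<and> gcd n (k - 1) = 1) \<or>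
         (odd (n * k) \<and> n \<ge> k \<and> 3 < k \<and> k < 200) \<or>
         (odd (n * k) \<and> n \<ge> k \<and> k \<ge> 3 \<and> n \<ge> (k - 2) * (k - 1))) \<and>
        v = 2 * n * k + t \<longrightarrow>
        (\<exists>\<F> :: (int \<times> int \<Rightarrow> int \<times> int) set.
           finite \<F> \<and>
           (\<forall>\<rho> \<in> \<F>.
              biembedding (multipartite v t) \<rho> \<and>
              embedding_aut (multipartite v t) \<rho> = cyclic_translations v \<and>
              (\<forall>F \<in> faces (multipartite v t) \<rho>. k dvd card F \<and> k < card F)) \<and>
           real (card \<F>) \<ge>
             (1 - 2 * real n / (real n * real k - (real k - 1))) *
             (1 - C / (real n * real k)) * fact (n * k) \<and>
           (prime v \<longrightarrow> t = 1 \<and> (\<forall>\<rho> \<in> \<F>. gonal (k * v) (multipartite v t) \<rho>)))"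
  proof (intro exI[of _ "real C"] allI impI, elim conjE)
    fix n k v :: nat
    assume n: "0 < n" and k: "0 < k" and kn: "k < n" and t: "t dvd 2 * n * k" and v: "v = 2 * n * k + t"
      and cases: "(odd (n * k) \<and> n \<ge> k \<and> k \<ge> 3 \<and> gcd n (k - 1) = 1) \<or>
         (odd (n * k) \<and> n \<ge> k \<and> 3 < k \<and> k < 200) \<or>
         (odd (n * k) \<and> n \<ge> k \<and> k \<ge> 3 \<and> n \<ge> (k - 2) * (k - 1))"
    have odd: "odd n" "odd k" and k3: "3 \<le> k" using cases by auto
    have t1: "t = 1" if "prime v"
    proof -
      have "t dvd v" using t by (simp add: v)
      then have "t = 1 \<or> t = v" using that by (simp add: prime_nat_iff)
      then show ?thesis using n k by (simp add: v)
    qed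
    define a where "a = 1 - 2 * real n / (real n * real k - (real k - 1))"
    have "2 * real n < real n * real k - (real k - 1)" by (rule nonzero_sum_proportion(1)[OF k3 kn])
    then have a: "0 \<le> a" "a \<le> 1" using n by (auto simp: a_def divide_simps)
    have nk: "0 < real n * real k" using n k by simp
    show "\<exists>\<F> :: (int \<times> int \<Rightarrow> int \<times> int) set.
           finite \<F> \<and>
           (\<forall>\<rho> \<in> \<F>.
              biembedding (multipartite v t) \<rho> \<and>
              embedding_aut (multipartite v t) \<rho> = cyclic_translations v \<and>
              (\<forall>F \<in> faces (multipartite v t) \<rho>. k dvd card F \<and> k < card F)) \<and>
           real (card \<F>) \<ge>
             (1 - 2 * real n / (real n * real k - (real k - 1))) *
             (1 - real C / (real n * real k)) * fact (n * k) \<and>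
           (prime v \<longrightarrow> t = 1 \<and> (\<forall>\<rho> \<in> \<F>. gonal (k * v) (multipartite v t) \<rho>))"
    proof (cases "n * k < C")
      case True
      then have "real n * real k < real C" by (simp flip: of_nat_mult)
      then have "1 - real C / (real n * real k) \<le> 0" using n k by (simp add: divide_simps)
      then have "a * (1 - real C / (real n * real k)) * fact (n * k) \<le> 0"
        using a by (intro mult_nonpos_nonneg mult_nonneg_nonpos) auto
      then show ?thesis using t1 unfolding a_def by (intro exI[of _ "{}"]) simp
    next
      case False
      let ?N = "n * k"
      have N: "2 ^ 20 * 18 ^ 18 \<le> ?N" "5 ^ 36 \<le> ?N" "40 * t \<le> ?N" "17 \<le> ?N" using False unfolding C_def by linarith+
      \<comment> \<open>Because \<open>k < n\<close>, the product \<open>n * k\<close> is less than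
        the square of \<open>n\<close>.\<close>
      have "5 ^ 18 < n"
      proof (rule ccontr)
        assume "\<not> 5 ^ 18 < n"
        then have "?N < 5 ^ 18 * 5 ^ 18" using kn n by (intro mult_le_less_imp_less) auto
        then show False using N(2) by simp
      qed
      moreover have "40 * t < 2 * n * k" using N(3,4) unfolding mult.assoc by linarith
      ultimately obtain \<F> where fin: "finite \<F>"
        and card: "2 ^ (?N - 17) * fact (?N - 17) \<le> 8 * card \<F>"
        and \<F>: "\<forall>\<rho>\<in>\<F>. biembedding (multipartite v t) \<rho> \<and>
          embedding_aut (multipartite v t) \<rho> = cyclic_translations v \<and>
          (\<forall>F\<in>faces (multipartite v t) \<rho>. k dvd card F \<and> k < card F) \<and>
          (prime v \<longrightarrow> gonal (k * v) (multipartite v t) \<rho>)"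
        using exists_rotation_family[OF assms(1) odd k3 _ t] unfolding v by blast
      have "8 * ?N ^ 17 * 2 ^ 17 \<le> 2 ^ (?N - 17) * 2 ^ 17"
        using power_le_two_power[OF N(1)] by (simp only: power_add[symmetric] le_add_diff_inverse2[OF N(4)])
      then have "8 * ?N ^ 17 \<le> 2 ^ (?N - 17)" by (simp only: mult_le_cancel2) simp
      then have "8 * (?N ^ 17 * fact (?N - 17)) \<le> 2 ^ (?N - 17) * (fact (?N - 17) :: nat)"
        unfolding mult.assoc[symmetric] by (rule mult_right_mono) simp
      also note card
      finally have "?N ^ 17 * fact (?N - 17) \<le> card \<F>" by simp
      then have "fact ?N \<le> card \<F>" using fact_le_power_mult_fact[OF N(4)] by linarith
      then have "real (fact ?N) \<le> real (card \<F>)" by (simp only: of_nat_le_iff)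
      then have f: "fact ?N \<le> real (card \<F>)" by simp
      have "0 \<le> real C / (real n * real k)" using nk by simp
      moreover have "real C \<le> real n * real k" using False by (simp flip: of_nat_mult)
      then have "real C / (real n * real k) \<le> 1" using nk by simp
      ultimately have "a * (1 - real C / (real n * real k)) \<le> 1"
        using a by (intro mult_le_one) auto
      then have "a * (1 - real C / (real n * real k)) * fact ?N \<le> 1 * fact ?N"
        by (intro mult_right_mono) auto
      then have "a * (1 - real C / (real n * real k)) * fact ?N \<le> real (card \<F>)"
        using f unfolding mult_1_left by (rule order_trans)
      then show ?thesis using fin \<F> t1 unfolding a_def by (intro exI[of _ \<F>]) blast
    qed
  qed
qed

end
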